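(* Let $E \subset \mathbb{C}$ be a compact set with connected complement $\mathbb{C}\setminus E$, and let $f \in A(E)$ have no zeros on $\overline{E^0}$. Then for every $\epsilon > 0$ there is a polynomial $P$ with complex coefficients having no zeros on $E$ and satisfying $|f(z) - P(z)| < \epsilon$ for all $z \in E$.
   Context: For a compact set $E \subset \mathbb{C}$, $E^0$ denotes the interior of $E$ in $\mathbb{C}$, $\overline{E^0}$ the closure of $E^0$, and $A(E)$ denotes the space of all continuous functions $E \to \mathbb{C}$ that are analytic in $E^0$. *)

theory Defs
  imports
    "HOL-Complex_Analysis.Complex_Analysis"
    "HOL-Computational_Algebra.Polynomial"
begin

(* Members are total functions, of which only the values on E matter. *)
definition cont_analytic :: "complex set \<Rightarrow> (complex \<Rightarrow> complex) set" where
  "cont_analytic E = {f. continuous_on E f \<and> f analytic_on interior E}"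

end

theory Submission
  imports Defs
begin

text \<open>
  First \<open>f\<close> is changed slightly, away from the interior of \<open>E\<close>, to remove its zeros: the set where
  \<open>\<bar>f\<bar>\<close> is small has empty interior, so every map from a closed part of it to a circle extends.
  A polynomial that approximates the new function closely enough has no zeros either, so
  Mergelyan's theorem remains.

  For Mergelyan's theorem, \<open>f\<close> is extended to the plane, with modulus of continuity \<open>\<omega>\<close>,
  and averaged over small squares of side \<open>d\<close>, which gives a function \<open>\<Phi>\<close> that is Lipschitz with constant \<open>2 \<omega>(d) / d\<close> and holomorphic at distance
  a few \<open>d\<close> inside \<open>E\<close>. On a grid of mesh \<open>d\<close>, \<open>\<Phi>\<close> is a Cauchy integral over a large square plus the
  sum over the cells \<open>Q\<close> of the defect, which is \<open>\<Phi>\<close> on \<open>Q\<close> (zero elsewhere) minus the Cauchy integral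
  of \<open>\<Phi>\<close> over \<open>\<partial>Q\<close>. The defect is \<open>O(\<omega>(d))\<close>, holomorphic off \<open>Q\<close>, and zero unless \<open>Q\<close> is near a
  point \<open>p\<close> outside \<open>E\<close>. In the latter case the complement of \<open>E\<close> contains an arc of diameter about \<open>d\<close>
  from \<open>p\<close>, and if \<open>g\<close> maps the outside of the arc conformally to the disc, a combination
  \<open>\<alpha> g + \<beta> g\<^sup>2\<close> agrees with the defect up to \<open>O(\<omega>(d) (d / \<bar>z - p\<bar>)\<^sup>3)\<close>. These errors have a sum
  of size \<open>O(\<omega>(d))\<close> over the grid, and the replaced sum is holomorphic near \<open>E\<close>, so Runge's theorem
  applies. Runge's theorem follows from the same grid decomposition.
\<close>

section \<open>Uniform limits of polynomials\<close>

text \<open>The restriction of \<open>f\<close> to \<open>K\<close> lies in the uniform closure of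
  the polynomials, the algebra usually written P(K). Values of \<open>f\<close> off \<open>K\<close>
  are irrelevant.\<close>

definition poly_approximable :: "complex set \<Rightarrow> (complex \<Rightarrow> complex) \<Rightarrow> bool" where
  "poly_approximable K f \<longleftrightarrow> (\<forall>e>0. \<exists>p. \<forall>z\<in>K. cmod (f z - poly p z) < e)"

lemma poly_approximable_limit:
  assumes "\<And>e. e > 0 \<Longrightarrow> \<exists>g. poly_approximable K g \<and> (\<forall>z\<in>K. cmod (f z - g z) < e)"
  shows "poly_approximable K f"
  unfolding poly_approximable_def
proof (intro allI impI)
  fix e :: real assume "e > 0"
  then obtain g where g: "poly_approximable K g" "\<And>z. z \<in> K \<Longrightarrow> cmod (f z - g z) < e/2"
    using assms[of "e/2"] by auto
  obtain p where p: "\<And>z. z \<in> K \<Longrightarrow> cmod (g z - poly p z) < e/2"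
    using g(1) \<open>e > 0\<close> unfolding poly_approximable_def by (meson half_gt_zero)
  have "cmod (f z - poly p z) < e" if "z \<in> K" for z
    using norm_triangle_lt[of "f z - g z" "g z - poly p z" e] g(2)[OF that] p[OF that] by simp
  then show "\<exists>p. \<forall>z\<in>K. cmod (f z - poly p z) < e" by blast
qed

lemma poly_approximable_cong:
  "(\<And>z. z \<in> K \<Longrightarrow> f z = g z) \<Longrightarrow> poly_approximable K f = poly_approximable K g"
  unfolding poly_approximable_def by simp

lemma poly_approximable_poly: "poly_approximable K (poly p)"
  unfolding poly_approximable_def by (auto intro!: exI[of _ p])

lemma poly_approximable_const: "poly_approximable K (\<lambda>z. c)"
  unfolding poly_approximable_def by (auto intro!: exI[of _ "[:c:]"])

lemma poly_approximable_ident: "poly_approximable K (\<lambda>z. z)"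
  unfolding poly_approximable_def by (auto intro!: exI[of _ "[:0,1:]"])

lemma poly_approximable_add:
  assumes "poly_approximable K f" "poly_approximable K g"
  shows "poly_approximable K (\<lambda>z. f z + g z)"
  unfolding poly_approximable_def
proof (intro allI impI)
  fix e :: real assume "e > 0"
  then obtain p q where p: "\<And>z. z \<in> K \<Longrightarrow> cmod (f z - poly p z) < e/2"
    and q: "\<And>z. z \<in> K \<Longrightarrow> cmod (g z - poly q z) < e/2"
    using assms unfolding poly_approximable_def by (meson half_gt_zero)
  have "cmod (f z + g z - poly (p + q) z) < e" if "z \<in> K" for z
    using norm_triangle_lt[of "f z - poly p z" "g z - poly q z" e] p[OF that] q[OF that]
    by (simp add: algebra_simps)
  then show "\<exists>p. \<forall>z\<in>K. cmod (f z + g z - poly p z) < e" by blast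
qed

lemma poly_approximable_bounded:
  assumes "poly_approximable K f" "compact K"
  obtains B where "B > 0" "\<And>z. z \<in> K \<Longrightarrow> cmod (f z) \<le> B"
proof -
  obtain p where p: "\<And>z. z \<in> K \<Longrightarrow> cmod (f z - poly p z) < 1"
    using assms(1) unfolding poly_approximable_def by (meson zero_less_one)
  have "compact (poly p ` K)"
    by (intro compact_continuous_image assms continuous_intros)
  then obtain B where B: "B > 0" "\<And>z. z \<in> K \<Longrightarrow> cmod (poly p z) \<le> B"
    using compact_imp_bounded bounded_pos by (metis imageI)
  show ?thesis
  proof
    show "cmod (f z) \<le> B + 1" if "z \<in> K" for z
      using norm_triangle_ineq[of "f z - poly p z" "poly p z"] p[OF that] B(2)[OF that] by simp
  qed (use B in simp)
qed

lemma poly_approximable_mult: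
  assumes "poly_approximable K f" "poly_approximable K g" "compact K"
  shows "poly_approximable K (\<lambda>z. f z * g z)"
proof -
  \<comment> \<open>One factor is replaced at a time. A polynomial factor is bounded on
    \<open>K\<close>, which settles the product with a fixed polynomial; then \<open>f\<close> is
    replaced by a polynomial, at the cost of a bound for \<open>g\<close>.\<close>
  have polyl: "poly_approximable K (\<lambda>z. poly p z * h z)" if h: "poly_approximable K h" for p h
    unfolding poly_approximable_def
  proof (intro allI impI)
    fix e :: real assume "e > 0"
    obtain B where B: "B > 0" "\<And>z. z \<in> K \<Longrightarrow> cmod (poly p z) \<le> B"
      using poly_approximable_bounded[OF poly_approximable_poly assms(3)] by blast
    obtain q where q: "\<And>z. z \<in> K \<Longrightarrow> cmod (h z - poly q z) < e / B"
      using h \<open>e > 0\<close> B(1) unfolding poly_approximable_def by (meson divide_pos_pos)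
    have "cmod (poly p z * h z - poly (p * q) z) < e" if "z \<in> K" for z
    proof -
      have "cmod (poly p z * h z - poly (p * q) z) = cmod (poly p z) * cmod (h z - poly q z)"
        by (simp add: norm_mult[symmetric] algebra_simps)
      also have "\<dots> \<le> B * cmod (h z - poly q z)"
        by (intro mult_right_mono B that) auto
      also have "\<dots> < e"
        using q[OF that] B(1) by (simp add: field_simps)
      finally show ?thesis .
    qed
    then show "\<exists>r. \<forall>z\<in>K. cmod (poly p z * h z - poly r z) < e" by blast
  qed
  show ?thesis
  proof (rule poly_approximable_limit)
    fix e :: real assume "e > 0"
    obtain B where B: "B > 0" "\<And>z. z \<in> K \<Longrightarrow> cmod (g z) \<le> B"
      using poly_approximable_bounded[OF assms(2,3)] by blast
    obtain p where p: "\<And>z. z \<in> K \<Longrightarrow> cmod (f z - poly p z) < e / B"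
      using assms(1) \<open>e > 0\<close> B(1) unfolding poly_approximable_def by (meson divide_pos_pos)
    have "cmod (f z * g z - poly p z * g z) < e" if "z \<in> K" for z
    proof -
      have "cmod (f z * g z - poly p z * g z) = cmod (f z - poly p z) * cmod (g z)"
        by (simp add: norm_mult[symmetric] algebra_simps)
      also have "\<dots> \<le> cmod (f z - poly p z) * B"
        by (intro mult_left_mono B that) auto
      also have "\<dots> < e"
        using p[OF that] B(1) by (simp add: field_simps)
      finally show ?thesis .
    qed
    then show "\<exists>h. poly_approximable K h \<and> (\<forall>z\<in>K. cmod (f z * g z - h z) < e)"
      using polyl[OF assms(2)] by blast
  qed
qed

lemma poly_approximable_sum:
  assumes "\<And>i. i \<in> I \<Longrightarrow> poly_approximable K (f i)"
  shows "poly_approximable K (\<lambda>z. \<Sum>i\<in>I. f i z)"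
  using assms
  by (induction I rule: infinite_finite_induct)
     (auto intro: poly_approximable_const poly_approximable_add)

lemma poly_approximable_power:
  assumes "poly_approximable K f" "compact K"
  shows "poly_approximable K (\<lambda>z. f z ^ n)"
  by (induction n) (auto intro: poly_approximable_const poly_approximable_mult assms)

text \<open>The Taylor polynomials of \<open>H\<close> at 0 converge uniformly on the smaller disc
  of radius \<open>r\<close>, and a polynomial in \<open>u\<close> is approximable because
  approximable functions form an algebra. Mostly used with \<open>u\<close> equal to the identity or
  to \<open>1 / (z - c)\<close>.\<close>

lemma poly_approximable_holomorphic_compose:
  assumes u: "poly_approximable K u" and K: "compact K"
    and H: "H holomorphic_on ball 0 R" and r: "\<And>z. z \<in> K \<Longrightarrow> cmod (u z) \<le> r" "r < R"
  shows "poly_approximable K (\<lambda>z. H (u z))"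
proof (cases "K = {}")
  case True
  then show ?thesis by (simp add: poly_approximable_def)
next
  case False
  then have "0 \<le> r" using r(1) norm_ge_zero order_trans by blast
  define a where "a n = (deriv ^^ n) H 0 / fact n" for n
  have sm: "(\<lambda>n. a n * w ^ n) sums H w" if "w \<in> ball 0 R" for w
    using holomorphic_power_series[OF H that] by (simp add: a_def)
  \<comment> \<open>Convergence at a radius strictly between \<open>r\<close> and \<open>R\<close>
    yields absolute convergence at \<open>r\<close>, as the M-test demands.\<close>
  have "\<exists>\<rho>. r < \<rho> \<and> \<rho> < R" using r(2) dense by blast
  then obtain \<rho> where \<rho>: "r < \<rho>" "\<rho> < R" by blast
  have "summable (\<lambda>n. a n * (of_real \<rho> :: complex) ^ n)"
    using sm[of "of_real \<rho>"] \<rho> \<open>0 \<le> r\<close> by (auto simp: sums_iff)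
  then have abs: "summable (\<lambda>n. norm (a n * (of_real r :: complex) ^ n))"
    by (rule powser_insidea) (use \<rho> \<open>0 \<le> r\<close> in auto)
  have unif: "uniform_limit (cball 0 r) (\<lambda>N w. \<Sum>n<N. a n * w ^ n) (\<lambda>w. \<Sum>n. a n * w ^ n) sequentially"
    by (rule Weierstrass_m_test[OF _ abs])
       (use \<open>0 \<le> r\<close> in \<open>auto simp: norm_mult norm_power intro!: mult_left_mono power_mono\<close>)
  show ?thesis
  proof (rule poly_approximable_limit)
    fix e :: real assume "e > 0"
    from eventually_happens'[OF sequentially_bot uniform_limitD[OF unif this]] obtain N where
      N: "\<forall>w\<in>cball 0 r. dist (\<Sum>n<N. a n * w ^ n) (\<Sum>n. a n * w ^ n) < e"
      by blast
    have "cmod (H (u z) - (\<Sum>n<N. a n * u z ^ n)) < e" if "z \<in> K" for z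
    proof -
      have "(\<Sum>n. a n * u z ^ n) = H (u z)"
        using sm[of "u z"] r(1)[OF that] r(2) by (auto simp: sums_iff)
      then show ?thesis
        using N[rule_format, of "u z"] r(1)[OF that] by (simp add: dist_norm norm_minus_commute)
    qed
    moreover have "poly_approximable K (\<lambda>z. \<Sum>n<N. a n * u z ^ n)"
      by (intro poly_approximable_sum poly_approximable_mult poly_approximable_const
          poly_approximable_power u K)
    ultimately show "\<exists>g. poly_approximable K g \<and> (\<forall>z\<in>K. cmod (H (u z) - g z) < e)"
      by blast
  qed
qed

section \<open>Moving poles off a compact set\<close>

text \<open>With \<open>u = 1 / (z - a)\<close> one has
  \<open>1 / (z - b) = u / (1 - (b - a) * u)\<close>. This is holomorphic in \<open>u\<close> up to
  radius \<open>1 / cmod (b - a)\<close>, which exceeds the bound \<open>1 / d\<close> of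
  \<open>u\<close> on \<open>K\<close>.\<close>

lemma poly_approximable_inverse_near:
  assumes K: "compact K" and a: "poly_approximable K (\<lambda>z. 1 / (z - a))"
    and d: "0 < d" "\<And>z. z \<in> K \<Longrightarrow> d \<le> cmod (z - a)" and b: "cmod (b - a) < d"
  shows "poly_approximable K (\<lambda>z. 1 / (z - b))"
proof (cases "b = a")
  case True
  then show ?thesis using a by simp
next
  case False
  define H where "H w = w / (1 - (b - a) * w)" for w
  have nz: "1 - (b - a) * w \<noteq> 0" if "w \<in> ball 0 (1 / cmod (b - a))" for w
  proof
    assume "1 - (b - a) * w = 0"
    then have "cmod (b - a) * cmod w = 1" by (metis eq_iff_diff_eq_0 norm_mult norm_one)
    then show False using that False by (simp add: field_simps)
  qed
  have "H holomorphic_on ball 0 (1 / cmod (b - a))"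
    unfolding H_def by (intro holomorphic_intros nz)
  then have "poly_approximable K (\<lambda>z. H (1 / (z - a)))"
  proof (rule poly_approximable_holomorphic_compose[OF a K])
    show "cmod (1 / (z - a)) \<le> 1 / d" if "z \<in> K" for z
      using d(2)[OF that] d(1) by (simp add: norm_divide frac_le)
    show "1 / d < 1 / cmod (b - a)"
      using b d(1) False by (simp add: frac_less2)
  qed
  moreover have "H (1 / (z - a)) = 1 / (z - b)" if "z \<in> K" for z
  proof -
    have "z \<noteq> a" using d(1) d(2)[OF that] by auto
    moreover have "z \<noteq> b" using d(2)[OF that] b by auto
    ultimately show ?thesis unfolding H_def by (simp add: divide_simps)
  qed
  ultimately show ?thesis
    using poly_approximable_cong by (metis (mono_tags, lifting))
qed

text \<open>The set \<open>S\<close> of admissible poles is open, relatively closed in the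
  complement of \<open>K\<close>, and contains a point far away. Connectedness of the complement
  makes it everything.\<close>

lemma poly_approximable_inverse_diff:
  assumes K: "compact K" and conn: "connected (- K)" and c: "c \<notin> K"
  shows "poly_approximable K (\<lambda>z. 1 / (z - c))"
proof -
  define S where "S = {a. a \<notin> K \<and> poly_approximable K (\<lambda>z. 1 / (z - a))}"
  have opn: "open (- K)" using K by (simp add: compact_imp_closed open_Compl)
  have sub: "S \<subseteq> - K" by (auto simp: S_def)
  \<comment> \<open>In a ball of radius \<open>e/3\<close> any two poles are closer to each other
    than either is to \<open>K\<close>, so admissibility passes between them in both directions.
    This serves for the openness of \<open>S\<close> and of its relative complement alike.\<close>
  have near: "\<exists>e>0. ball a e \<subseteq> - K \<and> (\<forall>b\<in>ball a e. \<forall>b'\<in>ball a e. b \<in> S \<longrightarrow> b' \<in> S)" if aK: "a \<in> - K" for a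
  proof -
    obtain e where e: "e > 0" "ball a e \<subseteq> - K" using openE[OF opn aK] by blast
    show ?thesis
    proof (intro exI[of _ "e/3"] conjI ballI impI)
      show sub3: "ball a (e/3) \<subseteq> - K"
        using e subset_ball[of "e/3" e a] by auto
      fix b b' assume b: "b \<in> ball a (e/3)" "b' \<in> ball a (e/3)" "b \<in> S"
      have far: "2*e/3 \<le> cmod (z - b)" if "z \<in> K" for z
      proof -
        have "\<not> dist a z < e" using e that by auto
        then show ?thesis using b(1) dist_triangle[of a z b] by (auto simp: dist_norm norm_minus_commute)
      qed
      have "cmod (b' - b) < 2*e/3"
        using b(1,2) dist_triangle[of b' b a] by (auto simp: dist_norm norm_minus_commute)
      moreover have "0 < 2*e/3" "poly_approximable K (\<lambda>z. 1 / (z - b))"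
        using e(1) b(3) by (simp_all add: S_def)
      ultimately have "poly_approximable K (\<lambda>z. 1 / (z - b'))"
        using poly_approximable_inverse_near[OF K] far by blast
      moreover have "b' \<notin> K" using b(2) sub3 by blast
      ultimately show "b' \<in> S" by (simp add: S_def)
    qed (use e in auto)
  qed
  have "open S"
    unfolding open_contains_ball using near sub
    by (meson centre_in_ball subset_iff)
  moreover have "open (- K - S)"
    unfolding open_contains_ball
  proof
    fix a assume a: "a \<in> - K - S"
    then obtain e where e: "e>0" "ball a e \<subseteq> - K" "\<forall>b\<in>ball a e. \<forall>b'\<in>ball a e. b \<in> S \<longrightarrow> b' \<in> S"
      using near by blast
    have "b \<notin> S" if "b \<in> ball a e" for b
      using e(1,3) that a by (metis DiffD2 centre_in_ball)
    then have "ball a e \<subseteq> - K - S" using e(2) by blast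
    then show "\<exists>e>0. ball a e \<subseteq> - K - S" using e(1) by blast
  qed
  moreover have "S \<noteq> {}"
  proof -
    obtain B where B: "B > 0" "\<And>z. z \<in> K \<Longrightarrow> cmod z \<le> B"
      using compact_imp_bounded[OF K] bounded_pos by metis
    \<comment> \<open>For a pole of modulus \<open>2 * B\<close>, the function
      \<open>1 / (w - a)\<close> is holomorphic on a disc strictly larger than one containing
      \<open>K\<close>.\<close>
    define a :: complex where "a = of_real (2 * B)"
    have na: "cmod a = 2 * B" unfolding a_def norm_of_real using B(1) by simp
    have "(\<lambda>w. 1 / (w - a)) holomorphic_on ball 0 (2 * B)"
      using na by (intro holomorphic_intros) auto
    from poly_approximable_holomorphic_compose[OF poly_approximable_ident K this B(2)] B(1)
    have "poly_approximable K (\<lambda>z. 1 / (z - a))" by simp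
    moreover have "a \<notin> K" using B(2)[of a] na B(1) by auto
    ultimately have "a \<in> S" by (simp add: S_def)
    then show ?thesis by blast
  qed
  ultimately have "- K - S = {}"
    using connectedD[OF conn, of S "- K - S"] sub by blast
  then show ?thesis using c by (auto simp: S_def)
qed

section \<open>Cauchy integrals over a grid\<close>

lemma contour_integral_rectpath:
  assumes "continuous_on (path_image (rectpath (Complex x0 y0) (Complex x1 y1))) h"
    and "x0 \<le> x1" "y0 \<le> y1"
  shows "contour_integral (rectpath (Complex x0 y0) (Complex x1 y1)) h =
    contour_integral (linepath (Complex x0 y0) (Complex x1 y0)) h +
    contour_integral (linepath (Complex x1 y0) (Complex x1 y1)) h -
    contour_integral (linepath (Complex x0 y1) (Complex x1 y1)) h -
    contour_integral (linepath (Complex x0 y0) (Complex x0 y1)) h"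
proof -
  have *: "path_image (rectpath (Complex x0 y0) (Complex x1 y1)) =
     closed_segment (Complex x0 y0) (Complex x1 y0) \<union> closed_segment (Complex x1 y0) (Complex x1 y1) \<union>
     closed_segment (Complex x1 y1) (Complex x0 y1) \<union> closed_segment (Complex x0 y1) (Complex x0 y0)"
    by (simp add: rectpath_def Let_def path_image_join Un_assoc)
  have c: "continuous_on (closed_segment (Complex x0 y0) (Complex x1 y0)) h"
    "continuous_on (closed_segment (Complex x1 y0) (Complex x1 y1)) h"
    "continuous_on (closed_segment (Complex x1 y1) (Complex x0 y1)) h"
    "continuous_on (closed_segment (Complex x0 y1) (Complex x0 y0)) h"
    by (rule continuous_on_subset[OF assms(1)]; force simp: *)+
  have i: "h contour_integrable_on linepath (Complex x0 y0) (Complex x1 y0)"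
    "h contour_integrable_on linepath (Complex x1 y0) (Complex x1 y1)"
    "h contour_integrable_on linepath (Complex x1 y1) (Complex x0 y1)"
    "h contour_integrable_on linepath (Complex x0 y1) (Complex x0 y0)"
    using c by (auto intro: contour_integrable_continuous_linepath)
  have r: "contour_integral (linepath (Complex x1 y1) (Complex x0 y1)) h = - contour_integral (linepath (Complex x0 y1) (Complex x1 y1)) h"
    "contour_integral (linepath (Complex x0 y1) (Complex x0 y0)) h = - contour_integral (linepath (Complex x0 y0) (Complex x0 y1)) h"
    using c(3,4) by (metis contour_integral_reverse_linepath)+
  show ?thesis
    using i by (simp add: rectpath_def Let_def r contour_integrable_joinI valid_path_join)
qed

lemma norm_contour_integral_rectpath_le:
  assumes "continuous_on (path_image (rectpath (Complex x0 y0) (Complex x1 y1))) h"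
    and "x0 \<le> x1" "y0 \<le> y1"
    and B: "\<And>\<zeta>. \<zeta> \<in> path_image (rectpath (Complex x0 y0) (Complex x1 y1)) \<Longrightarrow> cmod (h \<zeta>) \<le> B"
  shows "cmod (contour_integral (rectpath (Complex x0 y0) (Complex x1 y1)) h)
           \<le> 2 * B * ((x1 - x0) + (y1 - y0))"
proof -
  have *: "path_image (rectpath (Complex x0 y0) (Complex x1 y1)) =
     closed_segment (Complex x0 y0) (Complex x1 y0) \<union> closed_segment (Complex x1 y0) (Complex x1 y1) \<union>
     closed_segment (Complex x0 y1) (Complex x1 y1) \<union> closed_segment (Complex x0 y0) (Complex x0 y1)"
    by (auto simp add: rectpath_def Let_def path_image_join closed_segment_commute)
  have "0 \<le> B"
    using order_trans[OF norm_ge_zero B[of "Complex x0 y0"]] by (simp add: *)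
  have bd: "cmod (contour_integral (linepath a b) h) \<le> B * cmod (b - a)"
    if "closed_segment a b \<subseteq> path_image (rectpath (Complex x0 y0) (Complex x1 y1))" for a b
  proof (rule contour_integral_bound_linepath)
    show "h contour_integrable_on linepath a b"
      by (rule contour_integrable_continuous_linepath[OF continuous_on_subset[OF assms(1) that]])
    show "cmod (h x) \<le> B" if "x \<in> closed_segment a b" for x
      using B that \<open>closed_segment a b \<subseteq> _\<close> by blast
  qed (fact \<open>0 \<le> B\<close>)
  have h: "cmod (Complex x1 y - Complex x0 y) = x1 - x0" for y
    using assms(2) by (simp add: cmod_def)
  have v: "cmod (Complex x y1 - Complex x y0) = y1 - y0" for x
    using assms(3) by (simp add: cmod_def)
  have tri: "cmod (p + q - r - s) \<le> cmod p + cmod q + cmod r + cmod s" for p q r s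
    by norm
  have "cmod (contour_integral (rectpath (Complex x0 y0) (Complex x1 y1)) h) \<le>
      B * (x1 - x0) + B * (y1 - y0) + B * (x1 - x0) + B * (y1 - y0)"
    unfolding contour_integral_rectpath[OF assms(1-3)]
    using bd[of "Complex x0 y0" "Complex x1 y0"] bd[of "Complex x1 y0" "Complex x1 y1"]
      bd[of "Complex x0 y1" "Complex x1 y1"] bd[of "Complex x0 y0" "Complex x0 y1"]
    by (intro order_trans[OF tri] add_mono) (auto simp: h v *)
  then show ?thesis by (simp add: algebra_simps)
qed

lemma closed_segment_Complex_vertical:
  "closed_segment (Complex x a) (Complex x b) = Complex x ` closed_segment a b"
  by (subst closed_segment_same_Re) (auto simp: complex_eq_iff image_iff)

lemma closed_segment_Complex_horizontal:
  "closed_segment (Complex a y) (Complex b y) = (\<lambda>x. Complex x y) ` closed_segment a b"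
  by (subst closed_segment_same_Im) (auto simp: complex_eq_iff image_iff)

text \<open>The common vertical edge enters the two halves with opposite signs, and the horizontal
  edges concatenate. Only additivity of integrals is involved, so \<open>z\<close> may lie
  inside.\<close>

lemma contour_integral_rectpath_split_Re:
  assumes h: "continuous_on (- {z}) h" and "x0 \<le> x1" "x1 \<le> x2" "y0 \<le> y1"
    and z: "Re z \<notin> {x0, x1, x2}" "Im z \<notin> {y0, y1}"
  shows "contour_integral (rectpath (Complex x0 y0) (Complex x2 y1)) h =
    contour_integral (rectpath (Complex x0 y0) (Complex x1 y1)) h +
    contour_integral (rectpath (Complex x1 y0) (Complex x2 y1)) h"
proof -
  have c: "continuous_on (path_image (rectpath (Complex a y0) (Complex b y1))) h"
    if "a \<le> b" "Re z \<notin> {a, b}" for a b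
    using that assms(4) z(2) by (intro continuous_on_subset[OF h]) (auto simp: path_image_rectpath)
  have s: "contour_integral (linepath (Complex x0 y) (Complex x2 y)) h =
     contour_integral (linepath (Complex x0 y) (Complex x1 y)) h + contour_integral (linepath (Complex x1 y) (Complex x2 y)) h"
    if "y \<in> {y0, y1}" for y
    by (rule contour_integral_split_linepath)
       (use that assms in \<open>auto simp: closed_segment_Complex_horizontal closed_segment_eq_real_ivl
          intro!: continuous_on_subset[OF h]\<close>)
  show ?thesis
    using assms c s[of y0] s[of y1] by (simp add: contour_integral_rectpath)
qed

lemma contour_integral_rectpath_split_Im:
  assumes h: "continuous_on (- {z}) h" and "x0 \<le> x1" "y0 \<le> y1" "y1 \<le> y2"
    and z: "Re z \<notin> {x0, x1}" "Im z \<notin> {y0, y1, y2}"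
  shows "contour_integral (rectpath (Complex x0 y0) (Complex x1 y2)) h =
    contour_integral (rectpath (Complex x0 y0) (Complex x1 y1)) h +
    contour_integral (rectpath (Complex x0 y1) (Complex x1 y2)) h"
proof -
  have c: "continuous_on (path_image (rectpath (Complex x0 a) (Complex x1 b))) h"
    if "a \<le> b" "Im z \<notin> {a, b}" for a b
    using that assms(2) z(1) by (intro continuous_on_subset[OF h]) (auto simp: path_image_rectpath)
  have s: "contour_integral (linepath (Complex x y0) (Complex x y2)) h =
     contour_integral (linepath (Complex x y0) (Complex x y1)) h + contour_integral (linepath (Complex x y1) (Complex x y2)) h"
    if "x \<in> {x0, x1}" for x
    by (rule contour_integral_split_linepath)
       (use that assms in \<open>auto simp: closed_segment_Complex_vertical closed_segment_eq_real_ivl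
          intro!: continuous_on_subset[OF h]\<close>)
  show ?thesis
    using assms c s[of x0] s[of x1] by (simp add: contour_integral_rectpath)
qed

text \<open>The contributions of the inner edges of the grid cancel.\<close>

lemma contour_integral_grid:
  fixes X Y :: "nat \<Rightarrow> real"
  assumes h: "continuous_on (- {z}) h" and X: "mono X" and Y: "mono Y"
    and z: "\<And>i. Re z \<noteq> X i" "\<And>j. Im z \<noteq> Y j"
  shows "(\<Sum>i<m. \<Sum>j<n. contour_integral (rectpath (Complex (X i) (Y j)) (Complex (X (Suc i)) (Y (Suc j)))) h)
     = contour_integral (rectpath (Complex (X 0) (Y 0)) (Complex (X m) (Y n))) h"
proof -
  \<comment> \<open>Rectangles of zero width or height start the inductions over columns and
    rows.\<close>
  have triv: "contour_integral (rectpath (Complex a b) (Complex c d)) h = 0"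
    if "a = c \<or> b = d" "a \<le> c" "b \<le> d" "Re z \<noteq> a" "Im z \<noteq> b" "Re z \<noteq> c" "Im z \<noteq> d" for a b c d
  proof -
    have "continuous_on (path_image (rectpath (Complex a b) (Complex c d))) h"
      using that by (intro continuous_on_subset[OF h]) (auto simp: path_image_rectpath)
    then show ?thesis using that by (auto simp: contour_integral_rectpath)
  qed
  have col: "(\<Sum>j<n. contour_integral (rectpath (Complex a (Y j)) (Complex b (Y (Suc j)))) h)
     = contour_integral (rectpath (Complex a (Y 0)) (Complex b (Y n))) h"
    if "a \<le> b" "Re z \<noteq> a" "Re z \<noteq> b" for a b n
  proof (induction n)
    case 0
    show ?case using triv that z by simp
  next
    case (Suc n)
    have "Y 0 \<le> Y n" "Y n \<le> Y (Suc n)" using Y by (auto simp: monoD)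
    then show ?case
      using contour_integral_rectpath_split_Im[OF h that(1), of "Y 0" "Y n" "Y (Suc n)"] that z Suc by simp
  qed
  show ?thesis
  proof (induction m)
    case 0
    have "Y 0 \<le> Y n" using Y by (auto simp: monoD)
    then show ?case using triv z by simp
  next
    case (Suc m)
    have m: "X 0 \<le> X m" "X m \<le> X (Suc m)" "Y 0 \<le> Y n" using X Y by (auto simp: monoD)
    then show ?case
      using contour_integral_rectpath_split_Re[OF h m] z Suc col[OF m(2)] by simp
  qed
qed

text \<open>Normalised so that for \<Phi> holomorphic on the closed rectangle the value at an
  interior point is \<Phi> itself.\<close>

definition cauchy_rect :: "(complex \<Rightarrow> complex) \<Rightarrow> complex \<Rightarrow> complex \<Rightarrow> complex \<Rightarrow> complex" where
  "cauchy_rect \<Phi> a b z = contour_integral (rectpath a b) (\<lambda>\<zeta>. \<Phi> \<zeta> / (\<zeta> - z)) / (2 * of_real pi * \<i>)"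

text \<open>For smooth \<open>\<Phi>\<close> this is the Cauchy transform of the conjugate derivative of \<open>\<Phi>\<close> restricted to
  the rectangle.\<close>

definition cauchy_defect :: "(complex \<Rightarrow> complex) \<Rightarrow> complex \<Rightarrow> complex \<Rightarrow> complex \<Rightarrow> complex" where
  "cauchy_defect \<Phi> a b z = (if z \<in> box a b then \<Phi> z else 0) - cauchy_rect \<Phi> a b z"

text \<open>The Cauchy integrals over the cells add up to the one over the large square, and a point
  off the grid lines lies in exactly one open cell, whose defect supplies the value \<Phi> at that
  point.\<close>

lemma cauchy_grid_decomposition:
  fixes x y d :: real and N :: nat
  assumes \<Phi>: "continuous_on UNIV \<Phi>" and d: "d > 0"
    and z: "\<And>i::nat. Re z \<noteq> x + i * d" "\<And>j::nat. Im z \<noteq> y + j * d"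
    and zbox: "z \<in> box (Complex x y) (Complex (x + N * d) (y + N * d))"
  shows "\<Phi> z = cauchy_rect \<Phi> (Complex x y) (Complex (x + N * d) (y + N * d)) z +
     (\<Sum>(i,j)\<in>{..<N}\<times>{..<N}. cauchy_defect \<Phi> (Complex (x + real i * d) (y + real j * d))
        (Complex (x + real (Suc i) * d) (y + real (Suc j) * d)) z)"
proof -
  let ?h = "\<lambda>\<zeta>. \<Phi> \<zeta> / (\<zeta> - z)"
  have h: "continuous_on (- {z}) ?h"
    by (intro continuous_intros continuous_on_subset[OF \<Phi>]) auto
  have mono: "mono (\<lambda>i::nat. t + real i * d)" for t
    using d by (auto simp: mono_def)
  have A: "(\<Sum>(i,j)\<in>{..<N}\<times>{..<N}. cauchy_rect \<Phi> (Complex (x + real i * d) (y + real j * d))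
        (Complex (x + real (Suc i) * d) (y + real (Suc j) * d)) z)
     = cauchy_rect \<Phi> (Complex x y) (Complex (x + N * d) (y + N * d)) z"
    using contour_integral_grid[OF h mono mono, of x y N N] z
    by (simp add: sum.cartesian_product[symmetric] cauchy_rect_def sum_divide_distrib[symmetric])
  \<comment> \<open>The index is the floor of the rescaled coordinate. Since \<open>u\<close> is on
    no grid line, the lower inequality is strict too.\<close>
  have loc: "\<exists>i<N. \<forall>k. (t + real k * d < u \<and> u < t + real (Suc k) * d) \<longleftrightarrow> k = i"
    if u: "t < u" "u < t + N * d" "\<And>i::nat. u \<noteq> t + i * d" for t u
  proof -
    define i where "i = nat \<lfloor>(u - t) / d\<rfloor>"
    have q: "(u - t) / d > 0" using u(1) d by simp
    have i1: "real i \<le> (u - t) / d" "(u - t) / d < real i + 1"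
      using q unfolding i_def by linarith+
    have i2: "t + real i * d \<le> u" "u < t + (real i + 1) * d"
      using i1 d by (simp_all add: field_simps)
    have "real i < real N"
    proof -
      have "real i * d < real N * d" using i2 u by linarith
      then show ?thesis using d by simp
    qed
    then have "i < N" by simp
    moreover have "(t + real k * d < u \<and> u < t + real (Suc k) * d) \<longleftrightarrow> k = i" for k
    proof
      assume a: "t + real k * d < u \<and> u < t + real (Suc k) * d"
      have "real k * d < (real i + 1) * d" "real i * d < (real k + 1) * d"
        using a i2 by (auto simp: algebra_simps)
      then have "real k < real i + 1" "real i < real k + 1" using d by auto
      then show "k = i" by linarith
    next
      assume "k = i"
      then show "t + real k * d < u \<and> u < t + real (Suc k) * d"
        using i2 u(3)[of i] by (auto simp: algebra_simps)
    qed
    ultimately show ?thesis by blast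
  qed
  obtain i0 where i0: "i0 < N" "\<And>k. (x + real k * d < Re z \<and> Re z < x + real (Suc k) * d) \<longleftrightarrow> k = i0"
    using loc[of x "Re z"] zbox z(1) by (auto simp: in_box_complex_iff)
  obtain j0 where j0: "j0 < N" "\<And>k. (y + real k * d < Im z \<and> Im z < y + real (Suc k) * d) \<longleftrightarrow> k = j0"
    using loc[of y "Im z"] zbox z(2) by (auto simp: in_box_complex_iff)
  have "z \<in> box (Complex (x + real i * d) (y + real j * d))
        (Complex (x + real (Suc i) * d) (y + real (Suc j) * d)) \<longleftrightarrow> (i, j) = (i0, j0)" for i j
    using i0(2)[of i] j0(2)[of j] by (auto simp: in_box_complex_iff)
  then have "(\<Sum>(i,j)\<in>{..<N}\<times>{..<N}. if z \<in> box (Complex (x + real i * d) (y + real j * d))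
        (Complex (x + real (Suc i) * d) (y + real (Suc j) * d)) then \<Phi> z else 0)
      = (\<Sum>p\<in>{..<N}\<times>{..<N}. if p = (i0, j0) then \<Phi> z else 0)"
    by (intro sum.cong) (auto split: prod.split)
  also have "\<dots> = \<Phi> z" using i0(1) j0(1) by simp
  finally have B: "(\<Sum>(i,j)\<in>{..<N}\<times>{..<N}. if z \<in> box (Complex (x + real i * d) (y + real j * d))
        (Complex (x + real (Suc i) * d) (y + real (Suc j) * d)) then \<Phi> z else 0) = \<Phi> z" .
  show ?thesis
    unfolding cauchy_defect_def using A B by (simp add: case_prod_beta' sum_subtractf)
qed

section \<open>Cauchy integrals and defects as functions of the pole\<close>

lemma contour_integrable_continuous_rectpath:
  assumes "continuous_on (path_image (rectpath a b)) h"
  shows "h contour_integrable_on rectpath a b"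
proof -
  define c where "c = Complex (Re b) (Im a)"
  define d where "d = Complex (Re a) (Im b)"
  have eq: "rectpath a b = linepath a c +++ linepath c b +++ linepath b d +++ linepath d a"
    by (simp add: rectpath_def Let_def c_def d_def)
  have "h contour_integrable_on linepath u v" if "closed_segment u v \<subseteq> path_image (rectpath a b)" for u v
    by (rule contour_integrable_continuous_linepath[OF continuous_on_subset[OF assms that]])
  then have "h contour_integrable_on linepath a c" "h contour_integrable_on linepath c b"
    "h contour_integrable_on linepath b d" "h contour_integrable_on linepath d a"
    by (auto simp: eq path_image_join)
  then show ?thesis
    unfolding eq by (intro contour_integrable_joinI valid_path_join) auto
qed

text \<open>Differentiation under the integral sign: this is the case of exponent 1 in
  \<open>Cauchy_next_derivative\<close>, which is why the first power is written out.\<close>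

lemma holomorphic_on_linepath_integral:
  assumes "continuous_on (closed_segment a b) \<Phi>"
  shows "(\<lambda>z. contour_integral (linepath a b) (\<lambda>\<zeta>. \<Phi> \<zeta> / (\<zeta> - z))) holomorphic_on - closed_segment a b"
proof -
  have int: "((\<lambda>\<zeta>. \<Phi> \<zeta> / (\<zeta> - w) ^ 1) has_contour_integral
      contour_integral (linepath a b) (\<lambda>\<zeta>. \<Phi> \<zeta> / (\<zeta> - w))) (linepath a b)"
    if "w \<in> UNIV - path_image (linepath a b)" for w
  proof -
    have "(\<lambda>\<zeta>. \<Phi> \<zeta> / (\<zeta> - w)) contour_integrable_on linepath a b"
      by (rule contour_integrable_continuous_linepath) (use that in \<open>intro continuous_intros assms; auto\<close>)
    then show ?thesis by (simp add: has_contour_integral_integral)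
  qed
  have "\<exists>D. ((\<lambda>z. contour_integral (linepath a b) (\<lambda>\<zeta>. \<Phi> \<zeta> / (\<zeta> - z))) has_field_derivative D) (at z)"
    if "z \<notin> closed_segment a b" for z
  proof -
    have "continuous_on (path_image (linepath a b)) \<Phi>" using assms by simp
    moreover have "cmod (vector_derivative (linepath a b) (at t)) \<le> cmod (b - a)" for t
      by simp
    ultimately show ?thesis
      using Cauchy_next_derivative(2)[of "linepath a b" \<Phi> "cmod (b - a)" UNIV 1, OF _ _ int] that
      by (auto intro!: exI)
  qed
  then show ?thesis
    by (simp add: holomorphic_on_open open_Compl)
qed

lemma cauchy_rect_holomorphic:
  assumes \<Phi>: "continuous_on UNIV \<Phi>" and "Re a \<le> Re b" "Im a \<le> Im b"
  shows "cauchy_rect \<Phi> a b holomorphic_on - path_image (rectpath a b)"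
proof -
  obtain x0 y0 x1 y1 where ab: "a = Complex x0 y0" "b = Complex x1 y1" by (meson complex.exhaust)
  have sub: "closed_segment (Complex x0 y0) (Complex x1 y0) \<subseteq> path_image (rectpath a b)"
    "closed_segment (Complex x1 y0) (Complex x1 y1) \<subseteq> path_image (rectpath a b)"
    "closed_segment (Complex x0 y1) (Complex x1 y1) \<subseteq> path_image (rectpath a b)"
    "closed_segment (Complex x0 y0) (Complex x0 y1) \<subseteq> path_image (rectpath a b)"
    by (auto simp add: ab rectpath_def Let_def path_image_join closed_segment_commute)
  have c: "continuous_on S \<Phi>" for S using \<Phi> continuous_on_subset by blast
  have "(\<lambda>z. contour_integral (linepath u v) (\<lambda>\<zeta>. \<Phi> \<zeta> / (\<zeta> - z))) holomorphic_on - path_image (rectpath a b)"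
    if "closed_segment u v \<subseteq> path_image (rectpath a b)" for u v
    by (rule holomorphic_on_subset[OF holomorphic_on_linepath_integral[OF c]]) (use that in auto)
  note hol = this[OF sub(1)] this[OF sub(2)] this[OF sub(3)] this[OF sub(4)]
  have "(\<lambda>z. (contour_integral (linepath (Complex x0 y0) (Complex x1 y0)) (\<lambda>\<zeta>. \<Phi> \<zeta> / (\<zeta> - z)) +
    contour_integral (linepath (Complex x1 y0) (Complex x1 y1)) (\<lambda>\<zeta>. \<Phi> \<zeta> / (\<zeta> - z)) -
    contour_integral (linepath (Complex x0 y1) (Complex x1 y1)) (\<lambda>\<zeta>. \<Phi> \<zeta> / (\<zeta> - z)) -
    contour_integral (linepath (Complex x0 y0) (Complex x0 y1)) (\<lambda>\<zeta>. \<Phi> \<zeta> / (\<zeta> - z))) / (2 * of_real pi * \<i>))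
     holomorphic_on - path_image (rectpath a b)"
    by (intro holomorphic_intros hol) auto
  then show ?thesis
  proof (rule holomorphic_transform)
    fix z assume z: "z \<in> - path_image (rectpath a b)"
    have "continuous_on (path_image (rectpath a b)) (\<lambda>\<zeta>. \<Phi> \<zeta> / (\<zeta> - z))"
      by (intro continuous_intros c) (use z in auto)
    then show "(contour_integral (linepath (Complex x0 y0) (Complex x1 y0)) (\<lambda>\<zeta>. \<Phi> \<zeta> / (\<zeta> - z)) +
    contour_integral (linepath (Complex x1 y0) (Complex x1 y1)) (\<lambda>\<zeta>. \<Phi> \<zeta> / (\<zeta> - z)) -
    contour_integral (linepath (Complex x0 y1) (Complex x1 y1)) (\<lambda>\<zeta>. \<Phi> \<zeta> / (\<zeta> - z)) -
    contour_integral (linepath (Complex x0 y0) (Complex x0 y1)) (\<lambda>\<zeta>. \<Phi> \<zeta> / (\<zeta> - z))) / (2 * of_real pi * \<i>) =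
    cauchy_rect \<Phi> a b z"
      unfolding cauchy_rect_def ab using assms by (subst contour_integral_rectpath) (auto simp: ab)
  qed
qed

text \<open>For \<open>z\<close> twice as far out as the boundary, the kernel is at most
  \<open>2 / cmod z\<close>. The zero at infinity is what gives expansions in
  \<open>1 / (z - p)\<close> without a constant term.\<close>

lemma cauchy_rect_tendsto_0:
  assumes \<Phi>: "continuous_on UNIV \<Phi>" and "Re a \<le> Re b" "Im a \<le> Im b"
  shows "(cauchy_rect \<Phi> a b \<longlongrightarrow> 0) at_infinity"
proof -
  obtain x0 y0 x1 y1 where ab: "a = Complex x0 y0" "b = Complex x1 y1" by (meson complex.exhaust)
  have c: "continuous_on S \<Phi>" for S using \<Phi> continuous_on_subset by blast
  have cpt: "compact (path_image (rectpath a b))" by (rule compact_path_image[OF path_rectpath])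
  obtain R where R: "R > 0" "\<And>\<zeta>. \<zeta> \<in> path_image (rectpath a b) \<Longrightarrow> cmod \<zeta> \<le> R"
    using compact_imp_bounded[OF cpt] bounded_pos by metis
  obtain B where B: "B > 0" "\<And>\<zeta>. \<zeta> \<in> path_image (rectpath a b) \<Longrightarrow> cmod (\<Phi> \<zeta>) \<le> B"
    using compact_imp_bounded[OF compact_continuous_image[OF c cpt]] bounded_pos by (metis imageI)
  define C where "C = 2 * (2 * B) * ((x1 - x0) + (y1 - y0)) / (2 * pi)"
  have bd: "cmod (cauchy_rect \<Phi> a b z) \<le> C / cmod z" if z: "cmod z \<ge> 2 * R" for z
  proof -
    have far: "cmod z / 2 \<le> cmod (\<zeta> - z)" if "\<zeta> \<in> path_image (rectpath a b)" for \<zeta>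
      using R(2)[OF that] z norm_triangle_ineq2[of z \<zeta>] by (simp add: norm_minus_commute)
    have zpos: "cmod z > 0" using z R(1) by linarith
    have "cmod (contour_integral (rectpath a b) (\<lambda>\<zeta>. \<Phi> \<zeta> / (\<zeta> - z)))
         \<le> 2 * (2 * B / cmod z) * ((x1 - x0) + (y1 - y0))"
      unfolding ab
    proof (rule norm_contour_integral_rectpath_le)
      show "continuous_on (path_image (rectpath (Complex x0 y0) (Complex x1 y1))) (\<lambda>\<zeta>. \<Phi> \<zeta> / (\<zeta> - z))"
        by (intro continuous_intros c) (use far zpos in \<open>force simp: ab\<close>)
      fix \<zeta> assume \<zeta>: "\<zeta> \<in> path_image (rectpath (Complex x0 y0) (Complex x1 y1))"
      have "cmod (\<Phi> \<zeta> / (\<zeta> - z)) = cmod (\<Phi> \<zeta>) / cmod (\<zeta> - z)" by (simp add: norm_divide)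
      also have "\<dots> \<le> B / (cmod z / 2)"
        using B \<zeta> far[of \<zeta>] zpos by (intro frac_le) (auto simp: ab)
      finally show "cmod (\<Phi> \<zeta> / (\<zeta> - z)) \<le> 2 * B / cmod z" by (simp add: mult.commute)
    qed (use assms ab in auto)
    then have "cmod (contour_integral (rectpath a b) (\<lambda>\<zeta>. \<Phi> \<zeta> / (\<zeta> - z))) / (2 * pi)
         \<le> 2 * (2 * B / cmod z) * ((x1 - x0) + (y1 - y0)) / (2 * pi)"
      by (rule divide_right_mono) simp
    also have "\<dots> = C / cmod z" by (simp add: C_def)
    finally show ?thesis
      unfolding cauchy_rect_def by (simp add: norm_divide norm_mult)
  qed
  show ?thesis
  proof (rule Lim_null_comparison)
    show "\<forall>\<^sub>F z in at_infinity. cmod (cauchy_rect \<Phi> a b z) \<le> C / cmod z"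
      unfolding eventually_at_infinity using bd by blast
    show "((\<lambda>z::complex. C / cmod z) \<longlongrightarrow> 0) at_infinity"
      by (intro tendsto_divide_0[OF tendsto_const] filterlim_at_top_imp_at_infinity filterlim_norm_at_top)
  qed
qed

text \<open>Cauchy's integral formula inside the rectangle and Cauchy's theorem outside. Cells on
  which \<Phi> is holomorphic thus drop out of the grid decomposition.\<close>

lemma cauchy_defect_holomorphic_eq_0:
  assumes \<Phi>: "\<Phi> holomorphic_on cbox a b" and ab: "Re a \<le> Re b" "Im a \<le> Im b"
    and z: "z \<notin> path_image (rectpath a b)"
  shows "cauchy_defect \<Phi> a b z = 0"
proof (cases "z \<in> box a b")
  case True
  have "((\<lambda>w. \<Phi> w / (w - z)) has_contour_integral (2*pi * \<i> * winding_number (rectpath a b) z * \<Phi> z)) (rectpath a b)"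
    by (rule Cauchy_integral_formula_convex_simple[OF convex_box(1) \<Phi>])
       (use True z path_image_rectpath_subset_cbox[OF ab] in \<open>auto simp: interior_cbox\<close>)
  then show ?thesis
    using True winding_number_rectpath[OF True]
    by (simp add: cauchy_defect_def cauchy_rect_def contour_integral_unique)
next
  case False
  then have "z \<notin> cbox a b"
    using z path_image_rectpath_cbox_minus_box[OF ab] by auto
  then have "((\<lambda>w. \<Phi> w / (w - z)) has_contour_integral 0) (rectpath a b)"
    by (intro Cauchy_theorem_convex_simple[where S = "cbox a b"] holomorphic_intros \<Phi> convex_box
         path_image_rectpath_subset_cbox ab) auto
  then show ?thesis
    using False by (simp add: cauchy_defect_def cauchy_rect_def contour_integral_unique)
qed

text \<open>Let \<open>z0\<close> be the point of the closed square nearest to \<open>z\<close>.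
  Subtracting the constant \<open>\<Phi> z0\<close> under the integral absorbs the indicator term,
  and \<open>cmod (\<zeta> - z0) \<le> cmod (\<zeta> - z)\<close> bounds the new integrand by
  \<open>L\<close>. The perimeter is \<open>4 * d\<close>, and \<open>4 < 2 * pi\<close>.\<close>

lemma cauchy_defect_lipschitz_bound:
  assumes lip: "\<And>u v. cmod (\<Phi> u - \<Phi> v) \<le> L * cmod (u - v)" and d: "d > 0"
    and z: "z \<notin> path_image (rectpath (Complex x y) (Complex (x + d) (y + d)))"
  shows "cmod (cauchy_defect \<Phi> (Complex x y) (Complex (x + d) (y + d)) z) \<le> L * d"
proof -
  define a b where "a = Complex x y" and "b = Complex (x + d) (y + d)"
  have ab: "Re a \<le> Re b" "Im a \<le> Im b" using d by (auto simp: a_def b_def)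
  have z: "z \<notin> path_image (rectpath a b)" using z by (simp add: a_def b_def)
  have L: "L \<ge> 0" using lip[of 0 1] norm_ge_zero[of "\<Phi> 0 - \<Phi> 1"] by (simp del: norm_ge_zero)
  have cont: "continuous_on S \<Phi>" for S
    by (rule lipschitz_on_continuous_on[of L], rule lipschitz_onI) (use lip L in \<open>auto simp: dist_norm\<close>)
  have ne: "cbox a b \<noteq> {}" using ab by (auto simp: complex_eq_iff in_cbox_complex_iff intro!: exI[of _ a])
  define z0 where "z0 = closest_point (cbox a b) z"
  have near: "cmod (\<zeta> - z0) \<le> cmod (\<zeta> - z)" if "\<zeta> \<in> path_image (rectpath a b)" for \<zeta>
  proof -
    have "\<zeta> \<in> cbox a b" using that path_image_rectpath_subset_cbox[OF ab] by blast
    then show ?thesis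
      using closest_point_lipschitz[OF convex_box(1) closed_cbox ne, of \<zeta> z]
      by (simp add: z0_def closest_point_self dist_norm)
  qed
  let ?w = "winding_number (rectpath a b) z"
  \<comment> \<open>Inside the square the winding number is 1 and \<open>z0 = z\<close>; outside it
    is 0, so the choice of \<open>z0\<close> does not matter there.\<close>
  have w: "(if z \<in> box a b then \<Phi> z else 0) = ?w * \<Phi> z0"
  proof (cases "z \<in> box a b")
    case True
    then have "z \<in> cbox a b" using box_subset_cbox by blast
    then show ?thesis using True by (simp add: winding_number_rectpath z0_def closest_point_self)
  next
    case False
    then have "z \<notin> cbox a b" using z path_image_rectpath_cbox_minus_box[OF ab] by auto
    then show ?thesis using False ab by (simp add: winding_number_rectpath_outside)
  qed
  have c1: "continuous_on (path_image (rectpath a b)) (\<lambda>\<zeta>. (\<Phi> \<zeta> - \<Phi> z0) / (\<zeta> - z))"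
    by (intro continuous_intros cont) (use z in auto)
  have "((\<lambda>\<zeta>. \<Phi> z0 * (1 / (\<zeta> - z))) has_contour_integral \<Phi> z0 * (2 * of_real pi * \<i> * ?w)) (rectpath a b)"
    using has_contour_integral_lmul[OF has_contour_integral_winding_number[OF valid_path_rectpath z], of "\<Phi> z0"]
    by simp
  from has_contour_integral_add[OF has_contour_integral_integral[OF contour_integrable_continuous_rectpath[OF c1]] this]
  have "contour_integral (rectpath a b) (\<lambda>\<zeta>. \<Phi> \<zeta> / (\<zeta> - z)) =
     contour_integral (rectpath a b) (\<lambda>\<zeta>. (\<Phi> \<zeta> - \<Phi> z0) / (\<zeta> - z)) + \<Phi> z0 * (2 * of_real pi * \<i> * ?w)"
    by (intro contour_integral_unique) (simp add: diff_divide_distrib)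
  then have eq: "cauchy_defect \<Phi> a b z =
     - contour_integral (rectpath a b) (\<lambda>\<zeta>. (\<Phi> \<zeta> - \<Phi> z0) / (\<zeta> - z)) / (2 * of_real pi * \<i>)"
    unfolding cauchy_defect_def cauchy_rect_def w by (simp add: field_simps)
  have "cmod (contour_integral (rectpath a b) (\<lambda>\<zeta>. (\<Phi> \<zeta> - \<Phi> z0) / (\<zeta> - z))) \<le> 2 * L * ((x + d - x) + (y + d - y))"
    unfolding a_def b_def
  proof (rule norm_contour_integral_rectpath_le)
    fix \<zeta> assume "\<zeta> \<in> path_image (rectpath (Complex x y) (Complex (x + d) (y + d)))"
    then have \<zeta>: "\<zeta> \<in> path_image (rectpath a b)" by (simp add: a_def b_def)
    have "cmod (\<Phi> \<zeta> - \<Phi> z0) \<le> L * cmod (\<zeta> - z)"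
      using lip[of \<zeta> z0] mult_left_mono[OF near[OF \<zeta>] L] by linarith
    moreover have "cmod (\<zeta> - z) > 0" using z \<zeta> by auto
    ultimately show "cmod ((\<Phi> \<zeta> - \<Phi> z0) / (\<zeta> - z)) \<le> L" by (simp add: norm_divide field_simps)
  qed (use c1 d in \<open>auto simp: a_def b_def\<close>)
  then have "cmod (contour_integral (rectpath a b) (\<lambda>\<zeta>. (\<Phi> \<zeta> - \<Phi> z0) / (\<zeta> - z))) / (2 * pi)
      \<le> 4 * L * d / (2 * pi)"
    by (intro divide_right_mono) auto
  then have "cmod (cauchy_defect \<Phi> a b z) \<le> 4 * L * d / (2 * pi)"
    unfolding eq by (simp add: norm_divide norm_mult)
  also have "\<dots> \<le> L * d"
  proof -
    have "L * d * 4 \<le> L * d * (2 * pi)"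
      using L d pi_gt3 by (intro mult_left_mono) auto
    then show ?thesis by (simp add: field_simps)
  qed
  finally show ?thesis by (simp add: a_def b_def)
qed

text \<open>In the coordinate \<open>w = 1 / (z - p)\<close> infinity becomes 0, a removable
  singularity because of the limit there.\<close>

lemma holomorphic_at_infinity:
  assumes g: "g holomorphic_on {z. cmod (z - p) > R}" and "R > 0" and lim: "(g \<longlongrightarrow> 0) at_infinity"
  shows "(\<lambda>w. if w = 0 then 0 else g (p + 1 / w)) holomorphic_on ball 0 (1 / R)"
proof (rule no_isolated_singularity'[where K = "{0}"])
  let ?G = "\<lambda>w. if w = 0 then 0 else g (p + 1 / w)"
  have "(g \<circ> (\<lambda>w. p + 1 / w)) holomorphic_on (ball 0 (1 / R) - {0})"
  proof (rule holomorphic_on_compose)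
    show "(\<lambda>w. p + 1 / w) holomorphic_on ball 0 (1 / R) - {0}" by (intro holomorphic_intros) auto
    show "g holomorphic_on (\<lambda>w. p + 1 / w) ` (ball 0 (1 / R) - {0})"
      by (rule holomorphic_on_subset[OF g]) (use \<open>R > 0\<close> in \<open>auto simp: norm_divide field_simps\<close>)
  qed
  then show "?G holomorphic_on ball 0 (1 / R) - {0}"
    by (rule holomorphic_transform) auto
  fix w :: complex assume "w \<in> {0}"
  have "filterlim (\<lambda>w::complex. 1 / w) at_infinity (at 0)"
    using filterlim_inverse_at_infinity[where 'a = complex] by (simp only: inverse_eq_divide[abs_def])
  then have "filterlim (\<lambda>w. p + 1 / w) at_infinity (at 0)"
    by (rule tendsto_add_filterlim_at_infinity[OF tendsto_const])
  then have "((\<lambda>w. g (p + 1 / w)) \<longlongrightarrow> 0) (at 0)" by (rule filterlim_compose[OF lim])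
  then have "(?G \<longlongrightarrow> 0) (at 0)"
    by (rule Lim_transform_eventually) (auto simp: eventually_at_filter)
  then show "(?G \<longlongrightarrow> ?G w) (at w within ball 0 (1 / R))"
    using \<open>w \<in> {0}\<close> by (auto intro: tendsto_within_subset)
qed auto

section \<open>Runge's theorem\<close>

text \<open>The grid decomposition is available only off the grid lines. By continuity an estimate
  extends across them, since moving \<open>z\<close> a little along the diagonal leaves both
  families of lines.\<close>

lemma le_off_grid_imp_le:
  fixes g :: "complex \<Rightarrow> real"
  assumes M: "open M" "continuous_on M g" and d: "d > 0"
    and le: "\<And>z. z \<in> M \<Longrightarrow> (\<And>i::nat. Re z \<noteq> x + i * d) \<Longrightarrow> (\<And>j::nat. Im z \<noteq> y + j * d) \<Longrightarrow> g z \<le> c"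
    and z: "z \<in> M"
  shows "g z \<le> c"
proof -
  have off: "\<forall>\<^sub>F t in at_right 0. \<forall>i::nat. u + t \<noteq> a + i * d" for u a :: real
  proof -
    define k where "k = \<lfloor>(u - a) / d\<rfloor>"
    \<comment> \<open>The distance from \<open>u\<close> up to the next grid line strictly above it;
      smaller positive shifts meet no line.\<close>
    define s where "s = a + (k + 1) * d - u"
    have "(u - a) / d < k + 1" unfolding k_def by linarith
    then have "s > 0" using d by (simp add: s_def field_simps)
    have "real_of_int k \<le> (u - a) / d" by (simp add: k_def)
    then have k: "k * d \<le> u - a" using d by (simp add: field_simps)
    have "u + t \<noteq> a + i * d" if t: "0 < t" "t < s" for t and i :: nat
    proof
      assume eq: "u + t = a + i * d"
      have "k * d < i * d" using eq t(1) k by linarith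
      moreover have "i * d < (k + 1) * d" using eq t(2) by (simp add: s_def)
      ultimately have "real_of_int k < real i" "real i < real_of_int k + 1" using d by simp_all
      then have "real_of_int k < real_of_int (int i)" "real_of_int (int i) < real_of_int (k + 1)" by simp_all
      then show False unfolding of_int_less_iff by linarith
    qed
    then show ?thesis unfolding eventually_at_right_field using \<open>s > 0\<close> by (metis add_0)
  qed
  define p where "p t = z + Complex t t" for t :: real
  have p: "(p \<longlongrightarrow> z) (at_right 0)"
  proof -
    have "continuous_on UNIV p" unfolding p_def Complex_eq by (intro continuous_intros)
    then have "(p \<longlongrightarrow> p 0) (at 0)" by (simp add: continuous_on_def)
    then have "(p \<longlongrightarrow> p 0) (at_right 0)" by (rule tendsto_within_subset) simp
    moreover have "p 0 = z" by (simp add: p_def complex_eq_iff)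
    ultimately show ?thesis by simp
  qed
  have "continuous (at z) g" using M z by (simp add: continuous_on_eq_continuous_at)
  then have lim: "((\<lambda>t. g (p t)) \<longlongrightarrow> g z) (at_right 0)"
    using p by (rule isCont_tendsto_compose)
  have "\<forall>\<^sub>F t in at_right 0. p t \<in> M" using p M(1) z by (rule topological_tendstoD)
  then have "\<forall>\<^sub>F t in at_right 0. g (p t) \<le> c"
    using off[of "Re z" x] off[of "Im z" y]
  proof eventually_elim
    case (elim t)
    show ?case by (rule le[OF elim(1)]) (use elim in \<open>simp_all add: p_def\<close>)
  qed
  then show ?thesis using lim by (intro tendsto_upperbound[OF lim]) auto
qed

text \<open>In the grid decomposition of a continuous extension of \<open>f\<close>, cells inside
  the neighbourhood \<open>V\<close> have no defect. Each other cell misses \<open>K\<close>, so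
  near \<open>K\<close> its defect is minus a Cauchy integral, which is a holomorphic function of
  \<open>1 / (z - c)\<close> for a corner \<open>c\<close> of the cell; poles at such points are
  admissible because the complement is connected.\<close>

theorem runge_polynomial:
  assumes K: "compact K" and conn: "connected (- K)" and U: "open U" "K \<subseteq> U"
    and f: "f holomorphic_on U"
  shows "poly_approximable K f"
proof (cases "K = {}")
  case True
  then show ?thesis by (simp add: poly_approximable_def)
next
  case False
  obtain \<eta> where \<eta>: "\<eta> > 0" "(\<Union>x\<in>K. cball x \<eta>) \<subseteq> U"
    using compact_subset_open_imp_cball_epsilon_subset[OF K U] by metis
  define V where "V = {z. infdist z K \<le> \<eta>}"
  have V: "compact V" unfolding V_def by (rule compact_infdist_le) (use False K \<eta> in auto)
  have "V \<subseteq> U"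
  proof
    fix z assume "z \<in> V"
    obtain x where "x \<in> K" "infdist z K = dist z x"
      using infdist_attains_inf[OF compact_imp_closed[OF K] False] by blast
    then have "z \<in> cball x \<eta>" using \<open>z \<in> V\<close> by (simp add: V_def dist_commute)
    then show "z \<in> U" using \<open>x \<in> K\<close> \<eta>(2) by blast
  qed
  have "continuous_on V f"
    using f \<open>V \<subseteq> U\<close> continuous_on_subset holomorphic_on_imp_continuous_on by blast
  then obtain \<Phi> where \<Phi>: "continuous_on UNIV \<Phi>" "\<And>z. z \<in> V \<Longrightarrow> \<Phi> z = f z"
    using Tietze_unbounded[of V f UNIV] compact_imp_closed[OF V] by auto
  obtain B where B: "B > 0" "\<And>z. z \<in> K \<Longrightarrow> cmod z \<le> B"
    using compact_imp_bounded[OF K] bounded_pos by metis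
  \<comment> \<open>Cells have diameter at most \<open>2 * d\<close>, so a cell leaving
    \<open>V\<close> stays at distance at least \<open>\<eta> - 2 * d = 8 * d\<close> from
    \<open>K\<close>.\<close>
  define d where "d = \<eta> / 10"
  have d: "d > 0" using \<eta> by (simp add: d_def)
  define S where "S = B + 1"
  obtain N :: nat where N: "2 * S < N * d" using reals_Archimedean3[OF d] by blast
  define lo where "lo i j = Complex (- S + real i * d) (- S + real j * d)" for i j :: nat
  define hi where "hi i j = lo (Suc i) (Suc j)" for i j
  define bad where "bad = {(i, j). i < N \<and> j < N \<and> \<not> cbox (lo i j) (hi i j) \<subseteq> V}"
  define a b where "a = Complex (- S) (- S)" and "b = Complex (- S + N * d) (- S + N * d)"
  have fin: "finite bad" by (rule finite_subset[of _ "{..<N} \<times> {..<N}"]) (auto simp: bad_def)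
  have lohi: "Re (lo i j) \<le> Re (hi i j)" "Im (lo i j) \<le> Im (hi i j)" for i j
    using d by (auto simp: lo_def hi_def)
  have cell: "cmod (z - w) \<le> 2 * d" if "z \<in> cbox (lo i j) (hi i j)" "w \<in> cbox (lo i j) (hi i j)" for z w i j
  proof -
    have "\<bar>Re (z - w)\<bar> \<le> d" "\<bar>Im (z - w)\<bar> \<le> d"
      using that by (auto simp: in_cbox_complex_iff lo_def hi_def algebra_simps)
    then show ?thesis using cmod_le[of "z - w"] by linarith
  qed
  have badfar: "\<eta> - 2 * d \<le> cmod (z - w)" if ij: "(i, j) \<in> bad" and z: "z \<in> K" and w: "w \<in> cbox (lo i j) (hi i j)" for i j z w
  proof -
    obtain q where q: "q \<in> cbox (lo i j) (hi i j)" "q \<notin> V" using ij by (auto simp: bad_def)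
    have "\<eta> < dist q z" using q(2) infdist_le[OF z, of q] by (auto simp: V_def)
    then show ?thesis using cell[OF q(1) w] dist_triangle[of q z w] by (simp add: dist_norm norm_minus_commute)
  qed
  have disj: "z \<notin> cbox (lo i j) (hi i j)" if "(i, j) \<in> bad" "z \<in> K" for i j z
    using badfar[OF that, of z] \<eta>(1) by (auto simp: d_def)
  define \<Psi> where "\<Psi> z = cauchy_rect \<Phi> a b z - (\<Sum>(i,j)\<in>bad. cauchy_rect \<Phi> (lo i j) (hi i j) z)" for z
  define M where "M = box a b - (\<Union>(i,j)\<in>bad. cbox (lo i j) (hi i j))"
  have ab: "Re a \<le> Re b" "Im a \<le> Im b" using N B by (auto simp: a_def b_def S_def)
  have KM: "K \<subseteq> M"
  proof
    fix z assume z: "z \<in> K"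
    have "\<bar>Re z\<bar> \<le> B" "\<bar>Im z\<bar> \<le> B" using B(2)[OF z] abs_Re_le_cmod abs_Im_le_cmod order_trans by blast+
    then have "z \<in> box a b" using N by (auto simp: in_box_complex_iff a_def b_def S_def)
    then show "z \<in> M" using disj z by (auto simp: M_def)
  qed
  have "open M" unfolding M_def by (intro open_Diff closed_UN fin ballI) auto
  have hol_rect: "cauchy_rect \<Phi> (lo i j) (hi i j) holomorphic_on - cbox (lo i j) (hi i j)" for i j
    by (rule holomorphic_on_subset[OF cauchy_rect_holomorphic[OF \<Phi>(1) lohi]])
       (use path_image_rectpath_subset_cbox[OF lohi, of i j] in auto)
  have hol_big: "cauchy_rect \<Phi> a b holomorphic_on box a b"
    by (rule holomorphic_on_subset[OF cauchy_rect_holomorphic[OF \<Phi>(1) ab]])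
       (use path_image_rectpath_inter_box[OF ab] in auto)
  have "\<Psi> holomorphic_on M"
    unfolding \<Psi>_def
    by (intro holomorphic_intros holomorphic_on_subset[OF hol_big])
       (auto simp: M_def split: prod.splits intro!: holomorphic_on_subset[OF hol_rect])
  then have "continuous_on M (\<lambda>z. cmod (\<Phi> z - \<Psi> z))"
    by (intro continuous_intros continuous_on_subset[OF \<Phi>(1)] holomorphic_on_imp_continuous_on) auto
  \<comment> \<open>An equality written as a bound by 0, so that it extends by continuity across the
    grid lines.\<close>
  then have "cmod (\<Phi> z - \<Psi> z) \<le> 0" if "z \<in> M" for z
  proof (rule le_off_grid_imp_le[OF \<open>open M\<close> _ d _ that])
    fix z assume z: "z \<in> M" and off: "\<And>i::nat. Re z \<noteq> - S + i * d" "\<And>j::nat. Im z \<noteq> - S + j * d"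
    have zb: "z \<in> box a b" using z by (simp add: M_def)
    have good: "cauchy_defect \<Phi> (lo i j) (hi i j) z = 0" if "i < N" "j < N" "(i, j) \<notin> bad" for i j
    proof (rule cauchy_defect_holomorphic_eq_0[OF _ lohi])
      have sub: "cbox (lo i j) (hi i j) \<subseteq> V" using that by (auto simp: bad_def)
      then have "f holomorphic_on cbox (lo i j) (hi i j)" using f \<open>V \<subseteq> U\<close> holomorphic_on_subset by blast
      then show "\<Phi> holomorphic_on cbox (lo i j) (hi i j)"
        by (rule holomorphic_transform) (use \<Phi>(2) sub in auto)
      show "z \<notin> path_image (rectpath (lo i j) (hi i j))"
        using off[of i] off[of j] off[of "Suc i"] off[of "Suc j"] lohi
        by (auto simp: path_image_rectpath lo_def hi_def)
    qed
    have "(\<Sum>(i,j)\<in>{..<N}\<times>{..<N}. cauchy_defect \<Phi> (lo i j) (hi i j) z) = (\<Sum>(i,j)\<in>bad. cauchy_defect \<Phi> (lo i j) (hi i j) z)"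
      by (rule sum.mono_neutral_right) (use good in \<open>auto simp: bad_def\<close>)
    also have "\<dots> = (\<Sum>(i,j)\<in>bad. - cauchy_rect \<Phi> (lo i j) (hi i j) z)"
    proof (rule sum.cong[OF refl], clarify)
      fix i j assume "(i, j) \<in> bad"
      then have "z \<notin> cbox (lo i j) (hi i j)" using z by (auto simp: M_def)
      then have "z \<notin> box (lo i j) (hi i j)" using box_subset_cbox by blast
      then show "cauchy_defect \<Phi> (lo i j) (hi i j) z = - cauchy_rect \<Phi> (lo i j) (hi i j) z"
        by (simp add: cauchy_defect_def)
    qed
    also have "\<dots> = - (\<Sum>(i,j)\<in>bad. cauchy_rect \<Phi> (lo i j) (hi i j) z)"
      by (simp add: sum_negf case_prod_beta')
    finally have "\<Phi> z = \<Psi> z"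
      using cauchy_grid_decomposition[OF \<Phi>(1) d off zb[unfolded a_def b_def]]
      by (simp add: \<Psi>_def lo_def hi_def a_def b_def)
    then show "cmod (\<Phi> z - \<Psi> z) \<le> 0" by simp
  qed
  then have eq: "f z = \<Psi> z" if "z \<in> K" for z
  proof -
    have "z \<in> V" using that \<eta>(1) by (simp add: V_def)
    then show ?thesis using \<open>\<And>z. z \<in> M \<Longrightarrow> cmod (\<Phi> z - \<Psi> z) \<le> 0\<close> KM that \<Phi>(2) by force
  qed
  have P_big: "poly_approximable K (cauchy_rect \<Phi> a b)"
  proof (rule poly_approximable_holomorphic_compose[OF poly_approximable_ident K _ B(2)])
    show "cauchy_rect \<Phi> a b holomorphic_on ball 0 (B + 1)"
    proof (rule holomorphic_on_subset[OF hol_big], rule subsetI)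
      fix z :: complex assume "z \<in> ball 0 (B + 1)"
      then have "\<bar>Re z\<bar> < B + 1" "\<bar>Im z\<bar> < B + 1" using abs_Re_le_cmod[of z] abs_Im_le_cmod[of z] by auto
      then show "z \<in> box a b" using N by (auto simp: in_box_complex_iff a_def b_def S_def)
    qed
  qed auto
  have P_bad: "poly_approximable K (cauchy_rect \<Phi> (lo i j) (hi i j))" if ij: "(i, j) \<in> bad" for i j
  proof -
    \<comment> \<open>The Cauchy integral is holomorphic at distance more than \<open>2 * d\<close>
      from this corner, while \<open>K\<close> stays at distance at least \<open>8 * d\<close>; the
      gap gives uniform convergence in powers of \<open>1 / (z - c)\<close>.\<close>
    define c where "c = lo i j"
    have c_in: "c \<in> cbox (lo i j) (hi i j)" using lohi by (auto simp: c_def in_cbox_complex_iff)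
    have far: "8 * d \<le> cmod (z - c)" if "z \<in> K" for z
      using badfar[OF ij that c_in] by (simp add: d_def)
    have "c \<notin> K" using far[of c] d by auto
    have hol: "cauchy_rect \<Phi> (lo i j) (hi i j) holomorphic_on {z. cmod (z - c) > 2 * d}"
      by (rule holomorphic_on_subset[OF hol_rect]) (use cell[OF _ c_in] in force)
    define H where "H w = (if w = 0 then 0 else cauchy_rect \<Phi> (lo i j) (hi i j) (c + 1 / w))" for w
    have "H holomorphic_on ball 0 (1 / (2 * d))"
      unfolding H_def
      by (rule holomorphic_at_infinity[OF hol _ cauchy_rect_tendsto_0[OF \<Phi>(1) lohi]]) (use d in auto)
    then have "poly_approximable K (\<lambda>z. H (1 / (z - c)))"
    proof (rule poly_approximable_holomorphic_compose[OF poly_approximable_inverse_diff[OF K conn \<open>c \<notin> K\<close>] K])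
      show "cmod (1 / (z - c)) \<le> 1 / (8 * d)" if "z \<in> K" for z
        using far[OF that] d by (simp add: norm_divide frac_le)
      show "1 / (8 * d) < 1 / (2 * d)" using d by (simp add: field_simps)
    qed
    moreover have "H (1 / (z - c)) = cauchy_rect \<Phi> (lo i j) (hi i j) z" if "z \<in> K" for z
      using that \<open>c \<notin> K\<close> by (auto simp: H_def)
    ultimately show ?thesis using poly_approximable_cong by (metis (mono_tags, lifting))
  qed
  have "poly_approximable K (\<lambda>z. cauchy_rect \<Phi> a b z + (\<Sum>p\<in>bad. (-1) * cauchy_rect \<Phi> (lo (fst p) (snd p)) (hi (fst p) (snd p)) z))"
    by (intro poly_approximable_add poly_approximable_sum poly_approximable_mult poly_approximable_const K P_big P_bad) auto
  also have "(\<lambda>z. cauchy_rect \<Phi> a b z + (\<Sum>p\<in>bad. (-1) * cauchy_rect \<Phi> (lo (fst p) (snd p)) (hi (fst p) (snd p)) z)) = \<Psi>"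
    by (simp add: \<Psi>_def fun_eq_iff sum_negf case_prod_beta')
  finally show ?thesis using eq poly_approximable_cong by (metis (mono_tags, lifting))
qed

section \<open>Averaging over squares\<close>

definition seg_average :: "complex \<Rightarrow> real \<Rightarrow> (complex \<Rightarrow> complex) \<Rightarrow> complex \<Rightarrow> complex" where
  "seg_average u d F z = integral {0..d} (\<lambda>s. F (z + of_real s * u)) / of_real d"

context
  fixes u :: complex and d :: real and F :: "complex \<Rightarrow> complex"
  assumes u: "cmod u = 1" and d: "d > 0" and F: "continuous_on UNIV F"
begin

private lemma integrable_along: "(\<lambda>s. F (z + of_real s * u)) integrable_on {a..b}"
  by (intro integrable_continuous_interval continuous_on_compose2[OF F] continuous_intros) auto

lemma continuous_on_seg_average: "continuous_on UNIV (seg_average u d F)"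
proof -
  have "continuous_on (UNIV \<times> cbox 0 d) (\<lambda>(z, s). F (z + of_real s * u))"
    unfolding split_def by (intro continuous_on_compose2[OF F] continuous_intros) auto
  from integral_continuous_on_param[OF this]
  have "continuous_on UNIV (\<lambda>z. integral {0..d} (\<lambda>s. F (z + of_real s * u)))" by simp
  then show ?thesis
    unfolding seg_average_def[abs_def] using d by (intro continuous_intros) auto
qed

lemma seg_average_close:
  assumes "\<And>s. s \<in> {0..d} \<Longrightarrow> cmod (F (z + of_real s * u) - c) \<le> e"
  shows "cmod (seg_average u d F z - c) \<le> e"
proof -
  have "cmod (integral {0..d} (\<lambda>s. F (z + of_real s * u) - c)) \<le> e * (d - 0)"
    by (rule integral_bound) (use d assms in \<open>auto intro!: continuous_intros continuous_on_compose2[OF F]\<close>)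
  moreover have "integral {0..d} (\<lambda>s. F (z + of_real s * u) - c) = of_real d * (seg_average u d F z - c)"
    using d by (subst integral_diff[OF integrable_along]) (auto simp: seg_average_def algebra_simps scaleR_conv_of_real)
  ultimately have "d * cmod (seg_average u d F z - c) \<le> e * d"
    using d by (simp add: norm_mult)
  then show ?thesis using d by (simp add: mult.commute)
qed

text \<open>Averaging commutes with translation, so it preserves a modulus of continuity as well as
  a Lipschitz bound in another direction.\<close>

lemma seg_average_translate:
  assumes "\<And>z. cmod (F (z + v) - F z) \<le> e"
  shows "cmod (seg_average u d F (z + v) - seg_average u d F z) \<le> e"
proof -
  have "cmod (integral {0..d} (\<lambda>s. F (z + of_real s * u + v) - F (z + of_real s * u))) \<le> e * (d - 0)"
    by (rule integral_bound) (use d assms in \<open>auto intro!: continuous_intros continuous_on_compose2[OF F]\<close>)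
  moreover have "integral {0..d} (\<lambda>s. F (z + of_real s * u + v) - F (z + of_real s * u))
      = of_real d * (seg_average u d F (z + v) - seg_average u d F z)"
    using d integrable_along[of "z + v" 0 d] integrable_along[of z 0 d]
    by (subst integral_diff) (auto simp: seg_average_def algebra_simps)
  ultimately have "d * cmod (seg_average u d F (z + v) - seg_average u d F z) \<le> e * d"
    using d by (simp add: norm_mult)
  then show ?thesis using d by (simp add: mult.commute)
qed

text \<open>Shifting the segment by \<open>h\<close> along itself changes the integral only at its
  two ends: what remains is an integral of length \<open>h\<close> of differences of values at
  points \<open>d\<close> apart, each at most \<open>e\<close>.\<close>

lemma seg_average_lipschitz:
  assumes e: "\<And>z w. cmod (z - w) \<le> d \<Longrightarrow> cmod (F z - F w) \<le> e" and h: "h \<ge> 0"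
  shows "cmod (seg_average u d F (z + of_real h * u) - seg_average u d F z) \<le> e / d * h"
proof -
  define f where "f s = F (z + of_real s * u)" for s :: real
  have f: "f integrable_on {a..b}" for a b unfolding f_def by (rule integrable_along)
  have cf: "continuous_on S f" for S
    unfolding f_def by (intro continuous_on_compose2[OF F] continuous_intros) auto
  have 1: "integral {0..d} (\<lambda>s. F (z + of_real h * u + of_real s * u)) = integral {h..d + h} f"
    using integral_shift_Icc_real[of 0 d f h] by (simp add: o_def f_def algebra_simps)
  have 2: "integral {0..h} f + integral {h..d + h} f = integral {0..d + h} f"
    using d h by (intro Henstock_Kurzweil_Integration.integral_combine f) auto
  have 3: "integral {0..d} f + integral {d..d + h} f = integral {0..d + h} f"
    using d h by (intro Henstock_Kurzweil_Integration.integral_combine f) auto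
  have 4: "integral {d..d + h} f = integral {0..h} (\<lambda>s. f (d + s))"
    using integral_shift_Icc_real[of 0 h f d] by (simp add: o_def add.commute)
  have "integral {h..d + h} f - integral {0..d} f = integral {0..h} (\<lambda>s. f (d + s) - f s)"
  proof (subst integral_diff)
    show "(\<lambda>s. f (d + s)) integrable_on {0..h}"
      by (intro integrable_continuous_interval continuous_on_compose2[OF cf[of UNIV]] continuous_intros) auto
  qed (use f 2 3 4 in \<open>auto simp: algebra_simps\<close>)
  moreover have "cmod (integral {0..h} (\<lambda>s. f (d + s) - f s)) \<le> e * (h - 0)"
  proof (rule integral_bound)
    show "continuous_on {0..h} (\<lambda>s. f (d + s) - f s)"
      by (intro continuous_intros continuous_on_compose2[OF cf[of UNIV]]) auto
    show "cmod (f (d + s) - f s) \<le> e" for s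
      unfolding f_def by (rule e) (use u d in \<open>simp add: norm_mult algebra_simps\<close>)
  qed (use h in auto)
  ultimately have "cmod (integral {h..d + h} f - integral {0..d} f) \<le> e * h" by simp
  moreover have "seg_average u d F (z + of_real h * u) - seg_average u d F z
      = (integral {h..d + h} f - integral {0..d} f) / of_real d"
    unfolding seg_average_def 1 by (simp add: f_def[abs_def] diff_divide_distrib)
  ultimately show ?thesis using d by (simp add: norm_divide divide_right_mono)
qed

text \<open>With a primitive \<open>H\<close> of \<open>F\<close> on the larger ball, the average is
  the difference quotient \<open>(H (z + d * u) - H z) / (d * u)\<close>.\<close>

lemma holomorphic_on_seg_average:
  assumes hol: "F holomorphic_on ball c (r + d)"
  shows "seg_average u d F holomorphic_on ball c r"
proof -
  obtain H where H: "\<And>z. z \<in> ball c (r + d) \<Longrightarrow> (H has_field_derivative F z) (at z)"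
    using holomorphic_convex_primitive'[OF convex_ball open_ball hol]
    by (metis at_within_open open_ball)
  have shift: "z + of_real s * u \<in> ball c (r + d)" if "z \<in> ball c r" "s \<in> {0..d}" for z s
  proof -
    have "cmod (of_real s * u) \<le> d" using that(2) by (simp add: norm_mult u)
    then show ?thesis
      using that(1) norm_triangle_ineq4[of "c - z" "of_real s * u"] by (simp add: dist_norm algebra_simps)
  qed
  have "((\<lambda>s. F (z + of_real s * u)) has_integral (H (z + of_real d * u) / u - H (z + of_real 0 * u) / u)) {0..d}"
    if z: "z \<in> ball c r" for z
  proof (rule fundamental_theorem_of_calculus)
    fix s assume s: "s \<in> {0..d}"
    have "u \<noteq> 0" using u by auto
    have "((\<lambda>w. z + w * u) has_field_derivative u) (at (of_real s))"
      by (auto intro!: derivative_eq_intros)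
    from DERIV_chain2[where f = H and g = "\<lambda>w. z + w * u", OF H[OF shift[OF z s]] this]
    have "((\<lambda>w. H (z + w * u) / u) has_field_derivative F (z + of_real s * u) * u / u) (at (of_real s))"
      by (rule DERIV_cdivide)
    then have "((\<lambda>w. H (z + w * u) / u) has_field_derivative F (z + of_real s * u)) (at (of_real s))"
      using \<open>u \<noteq> 0\<close> by simp
    then show "((\<lambda>s. H (z + of_real s * u) / u) has_vector_derivative F (z + of_real s * u)) (at s within {0..d})"
      by (rule has_vector_derivative_real_field)
  qed (use d in auto)
  from integral_unique[OF this]
  have eq: "seg_average u d F z = (H (z + of_real d * u) - H z) / (of_real d * u)" if "z \<in> ball c r" for z
    unfolding seg_average_def using that by (simp add: diff_divide_distrib mult.commute)
  have "(\<lambda>z. (H (z + of_real d * u) - H z) / (of_real d * u)) holomorphic_on ball c r"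
  proof -
    have Hh: "H holomorphic_on ball c (r + d)"
      unfolding holomorphic_on_open[OF open_ball] using H by blast
    have "(H \<circ> (\<lambda>z. z + of_real d * u)) holomorphic_on ball c r"
      by (intro holomorphic_on_compose holomorphic_intros holomorphic_on_subset[OF Hh])
         (use shift d in auto)
    moreover have "H holomorphic_on ball c r"
      by (rule holomorphic_on_subset[OF Hh]) (use d in auto)
    ultimately show ?thesis
      unfolding o_def using u d by (intro holomorphic_intros) auto
  qed
  then show ?thesis by (rule holomorphic_transform) (simp add: eq)
qed

end

text \<open>\<open>\<Phi> z\<close> is the average of \<open>F\<close> over the square of side \<open>d\<close> with lower left corner \<open>z\<close>.\<close>

lemma lipschitz_regularisation:
  assumes F: "continuous_on UNIV F" and d: "d > 0"
    and e: "\<And>z w. cmod (z - w) \<le> d \<Longrightarrow> cmod (F z - F w) \<le> e"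
  obtains \<Phi> where "\<And>z. cmod (\<Phi> z - F z) \<le> 2 * e"
    "\<And>z w. cmod (\<Phi> z - \<Phi> w) \<le> 2 * e / d * cmod (z - w)"
    "\<And>c r. F holomorphic_on ball c (r + 2 * d) \<Longrightarrow> \<Phi> holomorphic_on ball c r"
proof -
  define F1 where "F1 = seg_average 1 d F"
  define \<Phi> where "\<Phi> = seg_average \<i> d F1"
  have F1: "continuous_on UNIV F1" unfolding F1_def by (intro continuous_on_seg_average d F) auto
  have "e \<ge> 0" using e[of 0 0] d by simp
  have F1_close: "cmod (F1 z - F z) \<le> e" for z
    unfolding F1_def by (rule seg_average_close[OF _ d F]) (use e d in auto)
  have F1_e: "cmod (F1 z - F1 w) \<le> e" if "cmod (z - w) \<le> d" for z w
    using seg_average_translate[OF _ d F, of 1 "z - w" e w] e that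
    by (simp add: F1_def)
  have F1_lip: "cmod (F1 (z + of_real h) - F1 z) \<le> e / d * h" if "h \<ge> 0" for z h
    using seg_average_lipschitz[OF _ d F e that, of 1 z] by (simp add: F1_def)
  have close: "cmod (\<Phi> z - F z) \<le> 2 * e" for z
  proof -
    have "cmod (\<Phi> z - F1 z) \<le> e"
      unfolding \<Phi>_def by (rule seg_average_close[OF _ d F1]) (use F1_e d in \<open>auto simp: norm_mult\<close>)
    then show ?thesis using F1_close[of z] norm_triangle_ineq[of "\<Phi> z - F1 z" "F1 z - F z"] by simp
  qed
  have lip_im: "cmod (\<Phi> (z + of_real h * \<i>) - \<Phi> z) \<le> e / d * h" if "h \<ge> 0" for z h
    using seg_average_lipschitz[OF _ d F1 F1_e that, of \<i> z] by (simp add: \<Phi>_def)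
  \<comment> \<open>The horizontal Lipschitz bound of the first average survives the vertical
    averaging.\<close>
  have lip_re: "cmod (\<Phi> (z + of_real h) - \<Phi> z) \<le> e / d * h" if "h \<ge> 0" for z h
    using seg_average_translate[OF _ d F1 F1_lip[OF that], of \<i> z] by (simp add: \<Phi>_def)
  have lip_re': "cmod (\<Phi> (z + of_real h) - \<Phi> z) \<le> e / d * \<bar>h\<bar>" for z h
    using lip_re[of h z] lip_re[of "-h" "z + of_real h"] by (cases "h \<ge> 0") (auto simp: norm_minus_commute)
  have lip_im': "cmod (\<Phi> (z + of_real h * \<i>) - \<Phi> z) \<le> e / d * \<bar>h\<bar>" for z h
    using lip_im[of h z] lip_im[of "-h" "z + of_real h * \<i>"] by (cases "h \<ge> 0") (auto simp: norm_minus_commute)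
  have lip: "cmod (\<Phi> z - \<Phi> w) \<le> 2 * e / d * cmod (z - w)" for z w
  proof -
    define a where "a = Re (z - w)"
    define b where "b = Im (z - w)"
    have z: "z = w + of_real a + of_real b * \<i>" by (simp add: a_def b_def complex_eq_iff)
    have "cmod (\<Phi> z - \<Phi> w) \<le> cmod (\<Phi> z - \<Phi> (w + of_real a)) + cmod (\<Phi> (w + of_real a) - \<Phi> w)"
      by norm
    also have "\<dots> \<le> e / d * \<bar>b\<bar> + e / d * \<bar>a\<bar>"
      using lip_im'[of "w + of_real a" b] lip_re'[of w a] z by simp
    also have "\<dots> \<le> e / d * cmod (z - w) + e / d * cmod (z - w)"
      unfolding a_def b_def using \<open>e \<ge> 0\<close> d
      by (intro add_mono mult_left_mono abs_Re_le_cmod abs_Im_le_cmod) auto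
    finally show ?thesis by (simp add: algebra_simps)
  qed
  have hol: "\<Phi> holomorphic_on ball c r" if "F holomorphic_on ball c (r + 2 * d)" for c r
    unfolding \<Phi>_def
  proof (rule holomorphic_on_seg_average[OF _ d F1])
    show "F1 holomorphic_on ball c (r + d)"
      unfolding F1_def by (rule holomorphic_on_seg_average[OF _ d F]) (use that in \<open>auto simp: algebra_simps\<close>)
  qed auto
  show ?thesis using that close lip hol by blast
qed

section \<open>Analytic capacity of arcs\<close>

text \<open>A non-sharp form of Koebe's one-quarter theorem. If \<open>F\<close> omits \<open>w\<close>, the branch of
  \<open>sqrt (1 - F / w)\<close> with value \<open>1\<close> at \<open>0\<close> omits both \<open>0\<close> and \<open>-1\<close>, so Schottky's
  theorem applies.\<close>

lemma univalent_omitted_value_bound: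
  obtains C :: real where "C > 0"
    and "\<And>F w. F holomorphic_on ball 0 1 \<Longrightarrow> inj_on F (ball 0 1) \<Longrightarrow> F 0 = 0 \<Longrightarrow>
           w \<notin> F ` ball 0 1 \<Longrightarrow> cmod (deriv F 0) \<le> C * cmod w"
proof -
  \<comment> \<open>Schottky's bound for a function of modulus at most 1 at the centre, on the disc
    of radius 1/2.\<close>
  define X :: real where "X = exp (pi * exp (pi * (2 + 2 * 1 + 12 * (1/2) / (1 - 1/2))))"
  have "cmod (deriv F 0) \<le> 4 * (1 + X^2) * cmod w"
    if hol: "F holomorphic_on ball 0 1" and inj: "inj_on F (ball 0 1)" and F0: "F 0 = 0"
      and w: "w \<notin> F ` ball 0 1" for F and w :: complex
  proof -
    have "0 \<in> F ` ball 0 1" using F0 by (metis centre_in_ball imageI zero_less_one)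
    then have "w \<noteq> 0" using w by metis
    define G where "G z = 1 - F z / w" for z
    have G: "G holomorphic_on ball 0 1" unfolding G_def by (intro holomorphic_intros hol \<open>w \<noteq> 0\<close>)
    have G_nz: "G z \<noteq> 0" if "z \<in> ball 0 1" for z
      using w that \<open>w \<noteq> 0\<close> by (auto simp: G_def)
    have "simply_connected (ball (0::complex) 1)" by (simp add: convex_imp_simply_connected)
    then have "\<exists>g. g holomorphic_on ball 0 1 \<and> (\<forall>z\<in>ball 0 1. G z = (g z)\<^sup>2)"
      using simply_connected_eq_holomorphic_sqrt[OF open_ball] G G_nz by blast
    then obtain g where g: "g holomorphic_on ball 0 1" "\<And>z. z \<in> ball 0 1 \<Longrightarrow> G z = (g z)\<^sup>2"
      by blast
    have g0: "(g 0)\<^sup>2 = 1" using g(2)[of 0] by (simp add: G_def F0)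
    \<comment> \<open>The sign gives \<open>m 0 = -1\<close>, so that the omitted values become 0
      and 1 as in Schottky's theorem. A point with \<open>m z = 1\<close> would have
      \<open>F z = 0\<close>, hence \<open>z = 0\<close> by injectivity.\<close>
    define m where "m z = - (g 0 * g z)" for z
    have m_sq: "(m z)\<^sup>2 = G z" if "z \<in> ball 0 1" for z
      using g(2)[OF that] g0 by (simp add: m_def power_mult_distrib)
    have m0: "m 0 = -1" using g0 by (simp add: m_def power2_eq_square)
    have m_ne1: "m z \<noteq> 1" if "z \<in> ball 0 1" for z
    proof
      assume "m z = 1"
      then have "G z = 1" using m_sq[OF that] by simp
      then have "F z = F 0" using \<open>w \<noteq> 0\<close> by (simp add: G_def F0)
      then have "z = 0" using inj that by (metis centre_in_ball inj_onD zero_less_one)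
      then show False using \<open>m z = 1\<close> m0 by simp
    qed
    have m_ne0: "m z \<noteq> 0" if "z \<in> ball 0 1" for z
      using m_sq[OF that] G_nz[OF that] by auto
    \<comment> \<open>Schottky's theorem needs the closed unit disc, so the argument is halved;
      radius 1/2 there is radius 1/4 for \<open>m\<close>.\<close>
    have half: "z / 2 \<in> ball 0 1" if "z \<in> cball 0 1" for z :: complex
      using that by (auto simp: norm_divide)
    have "(g \<circ> (\<lambda>z. z / 2)) holomorphic_on cball 0 1"
      by (intro holomorphic_on_compose holomorphic_on_subset[OF g(1)] holomorphic_intros)
         (use half in auto)
    then have mhol: "(\<lambda>z. m (z / 2)) holomorphic_on cball 0 1"
      unfolding m_def o_def by (intro holomorphic_intros)
    have bound: "cmod (m z) \<le> X" if z: "cmod z \<le> 1/4" for z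
    proof -
      have "cmod (m ((2 * z) / 2)) \<le> X"
        unfolding X_def
      proof (rule Schottky[OF mhol, where t = "1/2"])
        show "cmod (m (0 / 2)) \<le> 1" by (simp add: m0)
        show "cmod (2 * z) \<le> 1/2" using z by (simp add: norm_mult)
        show "\<not> (m (u / 2) = 0 \<or> m (u / 2) = 1)" if "u \<in> cball 0 1" for u
          using m_ne0[OF half[OF that]] m_ne1[OF half[OF that]] by blast
      qed auto
      then show ?thesis by simp
    qed
    have Fb: "cmod (F z) \<le> (1 + X^2) * cmod w" if z: "cmod z \<le> 1/4" for z
    proof -
      have "z \<in> ball 0 1" using z by simp
      then have "F z = w * (1 - (m z)\<^sup>2)" using m_sq \<open>w \<noteq> 0\<close> by (simp add: G_def)
      moreover have "cmod (1 - (m z)\<^sup>2) \<le> 1 + X^2"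
        using norm_triangle_ineq4[of 1 "(m z)\<^sup>2"] power_mono[OF bound[OF z] norm_ge_zero, of 2]
        by (simp add: norm_power)
      ultimately show ?thesis
        by (simp add: norm_mult mult.commute mult_left_mono)
    qed
    have "cmod ((deriv ^^ 1) F 0) \<le> fact 1 * ((1 + X^2) * cmod w) / (1/4)^1"
    proof (rule Cauchy_inequality)
      show "F holomorphic_on ball 0 (1/4)" by (rule holomorphic_on_subset[OF hol]) auto
      show "continuous_on (cball 0 (1/4)) F"
        by (rule continuous_on_subset[OF holomorphic_on_imp_continuous_on[OF hol]]) auto
    qed (use Fb in auto)
    then show ?thesis by (simp add: algebra_simps)
  qed
  moreover have "4 * (1 + X^2) > 0" by (simp add: add_pos_nonneg)
  ultimately show ?thesis using that by blast
qed

text \<open>The outside of an arc starting at \<open>p\<close>, in the coordinate \<open>w = 1 / (z - p)\<close> centred at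
  infinity.\<close>

lemma arc_complement_simply_connected:
  fixes \<gamma> :: "real \<Rightarrow> complex"
  assumes \<gamma>: "arc \<gamma>" "pathstart \<gamma> = p" and d: "d > 0" "path_image \<gamma> \<subseteq> cball p d"
  defines "\<Omega> \<equiv> insert 0 {w. w \<noteq> 0 \<and> p + 1 / w \<notin> path_image \<gamma>}"
  shows "open \<Omega>" "simply_connected \<Omega>" "ball 0 (1 / d) \<subseteq> \<Omega>"
proof -
  define T where "T = {w. w \<noteq> 0 \<and> p + 1 / w \<notin> path_image \<gamma>}"
  have inv0: "p + 1 / w \<in> - path_image \<gamma>" if "w \<in> ball 0 (1 / d)" "w \<noteq> 0" for w
  proof -
    have "cmod (1 / w) > d" using that d by (simp add: norm_divide field_simps)
    then show ?thesis using d by (auto simp: dist_norm subset_iff)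
  qed
  then show sub: "ball 0 (1 / d) \<subseteq> \<Omega>" by (auto simp: \<Omega>_def)
  have \<Omega>: "\<Omega> = T \<union> ball 0 (1 / d)" using sub by (auto simp: \<Omega>_def T_def d)
  have cl: "closed (path_image \<gamma>)" using \<gamma> by (simp add: closed_arc_image)
  have "open T"
  proof -
    have "open ((- {0}) \<inter> (\<lambda>w. p + 1 / w) -` (- path_image \<gamma>))"
      by (intro continuous_open_preimage continuous_intros) (use cl in auto)
    also have "(- {0}) \<inter> (\<lambda>w. p + 1 / w) -` (- path_image \<gamma>) = T" by (auto simp: T_def)
    finally show ?thesis .
  qed
  then show "open \<Omega>" unfolding \<Omega> by auto
  have p_in: "p \<in> path_image \<gamma>" using \<gamma>(2) pathstart_in_path_image by blast
  \<comment> \<open>Inversion carries the complement of the arc, which is connected, onto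
    \<open>T\<close>.\<close>
  have "T = (\<lambda>z. 1 / (z - p)) ` (- path_image \<gamma>)"
  proof
    show "T \<subseteq> (\<lambda>z. 1 / (z - p)) ` (- path_image \<gamma>)"
    proof
      fix w assume "w \<in> T"
      then show "w \<in> (\<lambda>z. 1 / (z - p)) ` (- path_image \<gamma>)"
        by (intro image_eqI[of _ _ "p + 1 / w"]) (auto simp: T_def)
    qed
    show "(\<lambda>z. 1 / (z - p)) ` (- path_image \<gamma>) \<subseteq> T"
      using p_in by (auto simp: T_def)
  qed
  moreover have "connected ((\<lambda>z. 1 / (z - p)) ` (- path_image \<gamma>))"
    by (intro connected_continuous_image connected_arc_complement continuous_intros)
       (use \<gamma> p_in in auto)
  ultimately have "connected T" by simp
  have "of_real (1 / (2 * d)) \<in> T \<inter> ball 0 (1 / d)"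
  proof -
    have "cmod (of_real (1 / (2 * d)) :: complex) < 1 / d"
      unfolding norm_of_real using d(1) by (simp add: field_simps)
    then show ?thesis using d(1) inv0[of "of_real (1 / (2 * d))"]
      by (simp add: T_def del: of_real_divide of_real_mult)
  qed
  then have conn: "connected \<Omega>"
    unfolding \<Omega> by (intro connected_Un \<open>connected T\<close>) auto
  have p0: "\<gamma> 0 = p" using \<gamma>(2) by (simp add: pathstart_def)
  have ne: "\<gamma> t \<noteq> p" if "t \<in> {0<..1}" for t
    using \<gamma>(1) that p0 inj_onD[of \<gamma> "{0..1}" t 0] by (auto simp: arc_def)
  \<comment> \<open>Inversion sends the starting point \<open>p\<close> to infinity. The complement
    of \<Omega> is therefore the image of a half-open interval: connected, and unbounded since
    \<open>\<gamma> t\<close> tends to \<open>p\<close> as \<open>t\<close> tends to 0.\<close>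
  have compl: "- \<Omega> = (\<lambda>t. 1 / (\<gamma> t - p)) ` {0<..1}"
  proof
    show "- \<Omega> \<subseteq> (\<lambda>t. 1 / (\<gamma> t - p)) ` {0<..1}"
    proof
      fix w assume "w \<in> - \<Omega>"
      then have w: "w \<noteq> 0" "p + 1 / w \<in> path_image \<gamma>" by (auto simp: \<Omega>_def)
      then obtain t where t: "t \<in> {0..1}" "\<gamma> t = p + 1 / w" by (auto simp: path_image_def)
      then have "t \<noteq> 0" using p0 w by auto
      then show "w \<in> (\<lambda>t. 1 / (\<gamma> t - p)) ` {0<..1}"
        using t by (intro image_eqI[of _ _ t]) auto
    qed
    show "(\<lambda>t. 1 / (\<gamma> t - p)) ` {0<..1} \<subseteq> - \<Omega>"
      using ne by (auto simp: \<Omega>_def path_image_def)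
  qed
  have cont: "continuous_on {0..1} \<gamma>" using \<gamma>(1) by (simp add: arc_def path_def)
  have "connected (- \<Omega>)" unfolding compl
    by (intro connected_continuous_image continuous_intros continuous_on_subset[OF cont])
       (use ne in auto)
  moreover have "- \<Omega> \<noteq> {}" unfolding compl by simp
  ultimately have comps: "components (- \<Omega>) = {- \<Omega>}" by (simp add: components_eq_sing_iff)
  have "\<not> bounded (- \<Omega>)"
  proof
    assume "bounded (- \<Omega>)"
    then obtain B where B: "B > 0" "\<And>w. w \<in> - \<Omega> \<Longrightarrow> cmod w \<le> B" by (metis bounded_pos)
    have "continuous (at 0 within {0..1}) \<gamma>" using cont by (simp add: continuous_on_eq_continuous_within)
    then obtain \<eta> where \<eta>: "\<eta> > 0" "\<And>t. t \<in> {0..1} \<Longrightarrow> dist t 0 < \<eta> \<Longrightarrow> dist (\<gamma> t) (\<gamma> 0) < 1 / B"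
      unfolding continuous_within_eps_delta using B(1) by (meson divide_pos_pos zero_less_one)
    define t where "t = min 1 (\<eta> / 2)"
    have t: "t \<in> {0<..1}" "dist t 0 < \<eta>" using \<eta>(1) by (auto simp: t_def min_def)
    then have "cmod (\<gamma> t - p) < 1 / B" using \<eta>(2)[of t] by (simp add: p0 dist_norm)
    moreover have "cmod (1 / (\<gamma> t - p)) \<le> B" using B(2) t unfolding compl by blast
    ultimately show False using ne[OF t(1)] B(1) by (simp add: norm_divide field_simps)
  qed
  then show "simply_connected \<Omega>"
    using simply_connected_eq_unbounded_complement_components[OF \<open>open \<Omega>\<close>] conn comps by simp
qed

text \<open>\<open>G\<close> is \<open>g\<close> in the coordinate \<open>w = 1 / (z - p)\<close>, so \<open>deriv G 0\<close> is the first Laurent coefficient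
  of \<open>g\<close> at infinity, and \<open>c\<close> is a lower bound for the analytic capacity of \<open>S\<close>.\<close>

definition has_pole_function :: "complex set \<Rightarrow> complex \<Rightarrow> real \<Rightarrow> real \<Rightarrow> bool" where
  "has_pole_function S p d c \<longleftrightarrow>
    (\<exists>g G. g holomorphic_on - S \<and> (\<forall>z\<in>- S. cmod (g z) \<le> 1) \<and>
      G holomorphic_on ball 0 (1 / d) \<and> G 0 = 0 \<and>
      (\<forall>w\<in>ball 0 (1 / d). w \<noteq> 0 \<longrightarrow> G w = g (p + 1 / w)) \<and> cmod (deriv G 0) \<ge> c)"

text \<open>Let \<open>G\<close> be the Riemann map of the inverted exterior \<Omega> with
  \<open>G 0 = 0\<close>. Its inverse \<open>F\<close> omits \<open>w0\<close>, the image of the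
  endpoint, of modulus \<open>1 / d\<close>. Hence \<open>deriv F 0\<close> has modulus at most
  \<open>C / d\<close>, and \<open>deriv G 0 * deriv F 0 = 1\<close> bounds \<open>deriv G 0\<close>
  from below.\<close>

lemma arc_analytic_capacity:
  "\<exists>\<kappa>>0. \<forall>\<gamma> p d. arc \<gamma> \<longrightarrow> pathstart \<gamma> = p \<longrightarrow> d > 0 \<longrightarrow> path_image \<gamma> \<subseteq> cball p d \<longrightarrow>
     cmod (pathfinish \<gamma> - p) = d \<longrightarrow> has_pole_function (path_image \<gamma>) p d (\<kappa> * d)"
proof -
  obtain C where C: "C > 0" "\<And>F w. F holomorphic_on ball 0 1 \<Longrightarrow> inj_on F (ball 0 1) \<Longrightarrow> F 0 = 0 \<Longrightarrow>
           w \<notin> F ` ball 0 1 \<Longrightarrow> cmod (deriv F 0) \<le> C * cmod w"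
    using univalent_omitted_value_bound by blast
  have main: "has_pole_function (path_image \<gamma>) p d (1 / C * d)"
    if \<gamma>: "arc \<gamma>" "pathstart \<gamma> = p" and d: "d > 0" "path_image \<gamma> \<subseteq> cball p d"
      and fin: "cmod (pathfinish \<gamma> - p) = d" for \<gamma> p d
  proof -
    define \<Omega> where "\<Omega> = insert 0 {w. w \<noteq> 0 \<and> p + 1 / w \<notin> path_image \<gamma>}"
    have \<Omega>: "open \<Omega>" "simply_connected \<Omega>" "ball 0 (1 / d) \<subseteq> \<Omega>"
      using arc_complement_simply_connected[OF \<gamma> d] by (simp_all add: \<Omega>_def)
    have "0 \<in> \<Omega>" by (simp add: \<Omega>_def)
    define w0 where "w0 = 1 / (pathfinish \<gamma> - p)"
    have w0: "w0 \<notin> \<Omega>" "cmod w0 = 1 / d"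
      using fin d(1) by (auto simp: \<Omega>_def w0_def norm_divide)
    obtain f h where f: "f holomorphic_on \<Omega>" "\<And>z. z \<in> \<Omega> \<Longrightarrow> f z \<in> ball 0 1" "\<And>z. z \<in> \<Omega> \<Longrightarrow> h (f z) = z"
      and h: "h holomorphic_on ball 0 1" "\<And>z. z \<in> ball 0 1 \<Longrightarrow> h z \<in> \<Omega>" "\<And>z. z \<in> ball 0 1 \<Longrightarrow> f (h z) = z"
      using Riemann_mapping_theorem[of \<Omega>] \<Omega>(1,2) \<open>0 \<in> \<Omega>\<close> w0(1) by blast
    \<comment> \<open>An automorphism of the disc moves \<open>f 0\<close> to 0.\<close>
    obtain m m' where m: "m (f 0) = 0" "m holomorphic_on ball 0 1" "m ` ball 0 1 \<subseteq> ball 0 1"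
      and m': "m' holomorphic_on ball 0 1" "m' ` ball 0 1 \<subseteq> ball 0 1"
      and mm': "\<And>z. z \<in> ball 0 1 \<Longrightarrow> m (m' z) = z" "\<And>z. z \<in> ball 0 1 \<Longrightarrow> m' (m z) = z"
      using ball_biholomorphism_exists[OF f(2)[OF \<open>0 \<in> \<Omega>\<close>]] by metis
    define G where "G = m \<circ> f"
    define F where "F = h \<circ> m'"
    have G: "G holomorphic_on \<Omega>" unfolding G_def
      by (intro holomorphic_on_compose f(1) holomorphic_on_subset[OF m(2)]) (use f(2) in blast)
    have F: "F holomorphic_on ball 0 1" unfolding F_def
      by (intro holomorphic_on_compose m'(1) holomorphic_on_subset[OF h(1)] m'(2))
    have GF: "G (F z) = z" if "z \<in> ball 0 1" for z
      using that m'(2) by (simp add: G_def F_def h(3) mm' image_subset_iff)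
    have G01: "G z \<in> ball 0 1" if "z \<in> \<Omega>" for z
      unfolding G_def o_def using f(2)[OF that] m(3) by blast
    have F\<Omega>: "F z \<in> \<Omega>" if "z \<in> ball 0 1" for z
      unfolding F_def o_def using that m'(2) h(2) by blast
    have G0: "G 0 = 0" by (simp add: G_def m(1))
    have F0: "F 0 = 0"
      using mm'(2)[OF f(2)[OF \<open>0 \<in> \<Omega>\<close>]] f(3)[OF \<open>0 \<in> \<Omega>\<close>] by (simp add: F_def m(1))
    have inj: "inj_on F (ball 0 1)" by (rule inj_on_inverseI[of _ G]) (rule GF)
    have "w0 \<notin> F ` ball 0 1" using F\<Omega> w0(1) by blast
    then have dF: "cmod (deriv F 0) \<le> C / d" using C(2)[OF F inj F0] w0(2) by fastforce
    have "((G \<circ> F) has_field_derivative deriv G (F 0) * deriv F 0) (at 0)"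
    proof (rule DERIV_chain)
      show "(G has_field_derivative deriv G (F 0)) (at (F 0))"
        using holomorphic_derivI[OF G \<Omega>(1)] \<open>0 \<in> \<Omega>\<close> by (simp add: F0)
      show "(F has_field_derivative deriv F 0) (at 0)"
        using holomorphic_derivI[OF F open_ball] by simp
    qed
    moreover have "((G \<circ> F) has_field_derivative 1) (at 0)"
      by (rule has_field_derivative_transform_within_open[OF DERIV_ident open_ball[of 0 1]])
         (use GF in auto)
    ultimately have "deriv G 0 * deriv F 0 = 1" using DERIV_unique F0 by metis
    then have one: "cmod (deriv G 0) * cmod (deriv F 0) = 1" by (metis norm_mult norm_one)
    have "1 \<le> cmod (deriv G 0) * (C / d)"
      using mult_left_mono[OF dF norm_ge_zero[of "deriv G 0"]] one by simp
    then have dG: "cmod (deriv G 0) \<ge> 1 / C * d"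
      using C(1) d(1) by (simp add: field_simps)
    define g where "g = G \<circ> (\<lambda>z. 1 / (z - p))"
    have p_in: "p \<in> path_image \<gamma>" using \<gamma>(2) pathstart_in_path_image by blast
    have im: "1 / (z - p) \<in> \<Omega>" if "z \<in> - path_image \<gamma>" for z
      using that p_in by (auto simp: \<Omega>_def)
    show ?thesis
      unfolding has_pole_function_def
    proof (intro exI conjI ballI impI)
      show "g holomorphic_on - path_image \<gamma>" unfolding g_def
        by (intro holomorphic_on_compose holomorphic_on_subset[OF G] holomorphic_intros)
           (use im p_in in auto)
      show "cmod (g z) \<le> 1" if "z \<in> - path_image \<gamma>" for z
        using G01[OF im[OF that]] by (simp add: g_def)
      show "G holomorphic_on ball 0 (1 / d)" by (rule holomorphic_on_subset[OF G \<Omega>(3)])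
      show "G w = g (p + 1 / w)" for w by (simp add: g_def)
    qed (use G0 dG in auto)
  qed
  have "1 / C > 0" using C(1) by simp
  with main show ?thesis by blast
qed

section \<open>Matching Laurent coefficients at infinity\<close>

text \<open>The Schwarz lemma for radius \<open>r\<close> and bound \<open>B\<close>: the quotient
  extends over 0, and the maximum principle on circles of radius close to \<open>r\<close> bounds
  it.\<close>

lemma holomorphic_factor_at_zero:
  assumes f: "f holomorphic_on ball 0 r" and r: "r > 0" and f0: "f 0 = 0"
    and B: "\<And>w. w \<in> ball 0 r \<Longrightarrow> cmod (f w) \<le> B"
  obtains h where "h holomorphic_on ball 0 r" "\<And>w. w \<in> ball 0 r \<Longrightarrow> f w = w * h w"
    "\<And>w. w \<in> ball 0 r \<Longrightarrow> cmod (h w) \<le> B / r" "h 0 = deriv f 0"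
proof
  let ?h = "\<lambda>z. if z = 0 then deriv f 0 else (f z - f 0) / (z - 0)"
  show hol: "?h holomorphic_on ball 0 r"
    by (rule pole_theorem_open_0[OF f open_ball]) (auto simp: f0)
  show "f w = w * ?h w" for w by (simp add: f0)
  show "?h 0 = deriv f 0" by simp
  fix w :: complex assume w: "w \<in> ball 0 r"
  show "cmod (?h w) \<le> B / r"
  proof (rule ccontr)
    assume neg: "\<not> cmod (?h w) \<le> B / r"
    have "B \<ge> 0" using B[of 0] r f0 by simp
    define q where "q = cmod (?h w)"
    have q: "q > B / r" using neg by (simp add: q_def)
    then have "q > 0" using \<open>B \<ge> 0\<close> r by (smt (verit) divide_nonneg_pos)
    \<comment> \<open>A radius \<rho> above both numbers encloses \<open>w\<close> and makes
      \<open>B / \<rho>\<close> smaller than \<open>q\<close>, against the maximum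
      principle.\<close>
    have "max (cmod w) (B / q) < r" using w q \<open>q > 0\<close> r by (simp add: field_simps)
    then obtain \<rho> where \<rho>: "max (cmod w) (B / q) < \<rho>" "\<rho> < r" using dense by blast
    have "\<rho> > 0" using \<rho>(1) norm_ge_zero[of w] by (simp del: norm_ge_zero)
    have "cmod (?h w) \<le> B / \<rho>"
    proof (rule maximum_modulus_frontier[where S = "cball 0 \<rho>" and f = ?h])
      show "?h holomorphic_on interior (cball 0 \<rho>)"
        by (rule holomorphic_on_subset[OF hol]) (use \<rho> in auto)
      show "continuous_on (closure (cball 0 \<rho>)) ?h"
        by (rule continuous_on_subset[OF holomorphic_on_imp_continuous_on[OF hol]]) (use \<rho> in auto)
      show "cmod (?h z) \<le> B / \<rho>" if "z \<in> frontier (cball 0 \<rho>)" for z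
      proof -
        have z: "cmod z = \<rho>" using that \<open>\<rho> > 0\<close> by simp
        then have "z \<noteq> 0" using \<open>\<rho> > 0\<close> by auto
        moreover have "cmod (f z) \<le> B" using B z \<rho> by simp
        ultimately show ?thesis using z \<open>\<rho> > 0\<close> by (simp add: f0 norm_divide divide_right_mono)
      qed
    qed (use \<rho> in auto)
    then have "q * \<rho> \<le> B" using \<open>\<rho> > 0\<close> by (simp add: q_def field_simps)
    moreover have "B < \<rho> * q" using \<rho>(1) \<open>q > 0\<close> by (simp add: field_simps)
    ultimately show False by (simp add: mult.commute)
  qed
qed

text \<open>The coefficients \<open>\<alpha>\<close> and \<open>\<beta>\<close> are chosen so that the Taylor coefficients of order 1 and 2 cancel.\<close>

lemma quadratic_matching:
  assumes F: "F holomorphic_on ball 0 r" "F 0 = 0" "\<And>w. w \<in> ball 0 r \<Longrightarrow> cmod (F w) \<le> M"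
    and G: "G holomorphic_on ball 0 r" "G 0 = 0" "\<And>w. w \<in> ball 0 r \<Longrightarrow> cmod (G w) \<le> 1"
    and r: "r > 0" and \<kappa>: "\<kappa> > 0" "cmod (deriv G 0) \<ge> \<kappa> / r"
  obtains \<alpha> \<beta> where "cmod \<alpha> \<le> M / \<kappa>" "cmod \<beta> \<le> M * (1 + 1 / \<kappa>) / \<kappa>^2"
    "\<And>w. w \<in> ball 0 r \<Longrightarrow> cmod (F w - \<alpha> * G w - \<beta> * (G w)^2)
        \<le> M * (1 + 1 / \<kappa>) * (1 + 1 / \<kappa>^2) * (cmod w / r)^3"
proof -
  have "M \<ge> 0" using F(3)[of 0] F(2) r by simp
  \<comment> \<open>Three divisions by the variable follow: \<open>F = w * a\<close>, then
    \<open>a - \<alpha> * b = w * k\<close>, then \<open>k - \<beta> * b^2 = w * m\<close>. Each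
    costs a factor \<open>1 / r\<close> in the bound, which produces the cube of
    \<open>cmod w / r\<close>.\<close>
  obtain a where a: "a holomorphic_on ball 0 r" "\<And>w. w \<in> ball 0 r \<Longrightarrow> F w = w * a w"
    "\<And>w. w \<in> ball 0 r \<Longrightarrow> cmod (a w) \<le> M / r"
    by (rule holomorphic_factor_at_zero[OF F(1) r F(2,3)]) (assumption, rule that)
  obtain b where b: "b holomorphic_on ball 0 r" "\<And>w. w \<in> ball 0 r \<Longrightarrow> G w = w * b w"
    "\<And>w. w \<in> ball 0 r \<Longrightarrow> cmod (b w) \<le> 1 / r" "b 0 = deriv G 0"
    by (rule holomorphic_factor_at_zero[OF G(1) r G(2,3)]) (assumption, rule that)
  have b0: "cmod (b 0) \<ge> \<kappa> / r" using b(4) \<kappa>(2) by simp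
  have "\<kappa> / r > 0" using \<kappa> r by simp
  then have b0_ne: "b 0 \<noteq> 0" using b0 by auto
  define \<alpha> where "\<alpha> = a 0 / b 0"
  have \<alpha>: "cmod \<alpha> \<le> M / \<kappa>"
  proof -
    have "cmod \<alpha> \<le> (M / r) / (\<kappa> / r)"
      unfolding \<alpha>_def norm_divide using a(3)[of 0] b0 \<open>\<kappa> / r > 0\<close> r \<open>M \<ge> 0\<close>
      by (intro frac_le) auto
    then show ?thesis using r by simp
  qed
  define N where "N = M * (1 + 1 / \<kappa>)"
  have N: "cmod (a w - \<alpha> * b w) \<le> N / r" if "w \<in> ball 0 r" for w
  proof -
    have "cmod \<alpha> * cmod (b w) \<le> (M / \<kappa>) * (1 / r)"
      using b(3)[OF that] \<alpha> \<open>M \<ge> 0\<close> \<kappa>(1) by (intro mult_mono) auto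
    then have "cmod (a w - \<alpha> * b w) \<le> M / r + (M / \<kappa>) * (1 / r)"
      using a(3)[OF that] norm_triangle_ineq4[of "a w" "\<alpha> * b w"] by (simp add: norm_mult)
    also have "\<dots> = N / r" unfolding N_def using r \<kappa>(1) by (simp add: field_simps)
    finally show ?thesis .
  qed
  have "N \<ge> 0" using \<open>M \<ge> 0\<close> \<kappa> by (simp add: N_def)
  have hol1: "(\<lambda>w. a w - \<alpha> * b w) holomorphic_on ball 0 r" by (intro holomorphic_intros a b)
  have z1: "a 0 - \<alpha> * b 0 = 0" using b0_ne by (simp add: \<alpha>_def)
  obtain k where k: "k holomorphic_on ball 0 r" "\<And>w. w \<in> ball 0 r \<Longrightarrow> a w - \<alpha> * b w = w * k w"
    "\<And>w. w \<in> ball 0 r \<Longrightarrow> cmod (k w) \<le> N / r / r"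
    by (rule holomorphic_factor_at_zero[OF hol1 r z1 N]) (assumption, rule that)
  define \<beta> where "\<beta> = k 0 / (b 0)^2"
  have \<beta>: "cmod \<beta> \<le> N / \<kappa>^2"
  proof -
    have "cmod \<beta> \<le> (N / r / r) / (\<kappa> / r)^2"
      unfolding \<beta>_def norm_divide norm_power using k(3)[of 0] b0 \<open>\<kappa> / r > 0\<close> r \<open>N \<ge> 0\<close>
      by (intro frac_le power_mono) auto
    then show ?thesis using r by (simp add: power2_eq_square)
  qed
  have bd2: "cmod (k w - \<beta> * (b w)^2) \<le> N * (1 + 1 / \<kappa>^2) / r^2" if "w \<in> ball 0 r" for w
  proof -
    have "cmod \<beta> * cmod (b w)^2 \<le> (N / \<kappa>^2) * (1 / r)^2"
      using b(3)[OF that] \<beta> \<open>N \<ge> 0\<close> \<kappa>(1) by (intro mult_mono power_mono) auto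
    then have "cmod (k w - \<beta> * (b w)^2) \<le> N / r / r + (N / \<kappa>^2) * (1 / r)^2"
      using k(3)[OF that] norm_triangle_ineq4[of "k w" "\<beta> * (b w)^2"]
      by (simp add: norm_mult norm_power)
    also have "\<dots> = N * (1 + 1 / \<kappa>^2) / r^2"
      using r \<kappa>(1) by (simp add: field_simps power2_eq_square)
    finally show ?thesis .
  qed
  have hol2: "(\<lambda>w. k w - \<beta> * (b w)^2) holomorphic_on ball 0 r" by (intro holomorphic_intros k b)
  have z2: "k 0 - \<beta> * (b 0)^2 = 0" using b0_ne by (simp add: \<beta>_def)
  obtain m where m: "\<And>w. w \<in> ball 0 r \<Longrightarrow> k w - \<beta> * (b w)^2 = w * m w"
    "\<And>w. w \<in> ball 0 r \<Longrightarrow> cmod (m w) \<le> N * (1 + 1 / \<kappa>^2) / r^2 / r"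
    by (rule holomorphic_factor_at_zero[OF hol2 r z2 bd2]) (assumption, rule that)
  show ?thesis
  proof (rule that[OF \<alpha> \<beta>[unfolded N_def]])
    fix w :: complex assume w: "w \<in> ball 0 r"
    have "F w - \<alpha> * G w - \<beta> * (G w)^2 = w * (a w - \<alpha> * b w) - w^2 * (\<beta> * (b w)^2)"
      using a(2)[OF w] b(2)[OF w] by (simp add: algebra_simps power2_eq_square)
    also have "\<dots> = w^2 * (k w - \<beta> * (b w)^2)"
      unfolding k(2)[OF w] by (simp add: algebra_simps power2_eq_square)
    also have "\<dots> = w^3 * m w"
      unfolding m(1)[OF w] by (simp add: power2_eq_square power3_eq_cube)
    finally have "cmod (F w - \<alpha> * G w - \<beta> * (G w)^2) = cmod w^3 * cmod (m w)"
      by (simp add: norm_mult norm_power)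
    also have "\<dots> \<le> cmod w^3 * (N * (1 + 1 / \<kappa>^2) / r^2 / r)"
      by (intro mult_left_mono m(2) w) auto
    also have "\<dots> = N * (1 + 1 / \<kappa>^2) * (cmod w / r)^3"
      by (simp add: power2_eq_square power3_eq_cube power_divide)
    finally show "cmod (F w - \<alpha> * G w - \<beta> * (G w)^2)
        \<le> M * (1 + 1 / \<kappa>) * (1 + 1 / \<kappa>^2) * (cmod w / r)^3" by (simp add: N_def)
  qed
qed

section \<open>Mergelyan's theorem\<close>

text \<open>A path in the complement of \<open>K\<close> from \<open>p\<close> to a distant point is
  cut where it reaches the circle of radius \<open>d\<close>, and an arc with the same ends is taken
  from it. The endpoint at distance exactly \<open>d\<close> makes its analytic capacity comparable
  to \<open>d\<close>.\<close>

lemma arc_reaching_distance: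
  assumes K: "compact K" and conn: "connected (- K)" and p: "p \<notin> K" and d: "d > 0"
  obtains \<gamma> where "arc \<gamma>" "pathstart \<gamma> = p" "path_image \<gamma> \<subseteq> cball p d - K"
    "cmod (pathfinish \<gamma> - p) = d"
proof -
  obtain B where B: "B > 0" "\<And>z. z \<in> K \<Longrightarrow> cmod z \<le> B"
    using compact_imp_bounded[OF K] bounded_pos by metis
  define q :: complex where "q = of_real (B + cmod p + d + 1)"
  have nq: "cmod q = B + cmod p + d + 1"
    unfolding q_def norm_of_real using B(1) d norm_ge_zero[of p] by linarith
  have "q \<notin> K" using B(2)[of q] nq d norm_ge_zero[of p] by fastforce
  have "cmod (q - p) > d" using norm_triangle_ineq2[of q p] nq B(1) by linarith
  have "path_connected (- K)"
    using K conn by (simp add: compact_imp_closed connected_open_path_connected open_Compl)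
  then obtain g where g: "path g" "path_image g \<subseteq> - K" "pathstart g = p" "pathfinish g = q"
    using p \<open>q \<notin> K\<close> unfolding path_connected_def by (metis ComplI)
  have "pathstart g \<in> cball p d" "pathfinish g \<notin> cball p d"
    using g(3,4) d \<open>cmod (q - p) > d\<close> by (simp_all add: dist_norm norm_minus_commute)
  then obtain h where h: "path h" "pathstart h = pathstart g" "path_image h \<subseteq> path_image g \<inter> cball p d"
    "pathfinish h \<in> frontier (cball p d)"
    using exists_path_subpath_to_frontier_closed[OF closed_cball g(1)] by metis
  have fin: "cmod (pathfinish h - p) = d" using h(4) d by (simp add: dist_norm norm_minus_commute)
  then have "pathfinish h \<noteq> p" using d by auto
  then obtain \<gamma> where \<gamma>: "arc \<gamma>" "path_image \<gamma> \<subseteq> path_image h" "pathstart \<gamma> = p" "pathfinish \<gamma> = pathfinish h"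
    using path_contains_arc[OF h(1), of p "pathfinish h"] h(2) g(3) by metis
  show ?thesis
    by (rule that[of \<gamma>]) (use \<gamma> h(3) g(2) fin in auto)
qed

text \<open>The replacement is \<open>\<alpha> * g + \<beta> * g^2\<close> with \<open>g\<close> the
  pole function of an arc from \<open>p\<close> outside \<open>K\<close>. Far from the cell the
  matched coefficients give cubic decay; near it both functions are bounded by a multiple of
  \<open>L * d\<close>. The leading quantifier makes \<open>C\<close> universal.\<close>

lemma cauchy_defect_replacement:
  "\<exists>C>0. \<forall>K \<Phi> L d x y p. compact K \<longrightarrow> connected (- K) \<longrightarrow> d > 0 \<longrightarrow>
      (\<forall>u v. cmod (\<Phi> u - \<Phi> v) \<le> L * cmod (u - v)) \<longrightarrow> p \<notin> K \<longrightarrow> cmod (p - Complex x y) \<le> 5 * d \<longrightarrow>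
      (\<exists>G U. open U \<and> K \<subseteq> U \<and> G holomorphic_on U \<and>
        (\<forall>z\<in>U. z \<notin> path_image (rectpath (Complex x y) (Complex (x + d) (y + d))) \<longrightarrow>
          cmod (cauchy_defect \<Phi> (Complex x y) (Complex (x + d) (y + d)) z - G z)
            \<le> C * (L * d) / (1 + cmod (z - Complex x y) / d) ^ 3))"
proof -
  obtain \<kappa> where \<kappa>: "\<kappa> > 0"
    and cap: "\<forall>\<gamma> p d. arc \<gamma> \<longrightarrow> pathstart \<gamma> = p \<longrightarrow> d > 0 \<longrightarrow> path_image \<gamma> \<subseteq> cball p d \<longrightarrow>
      cmod (pathfinish \<gamma> - p) = d \<longrightarrow> has_pole_function (path_image \<gamma>) p d (\<kappa> * d)"
    using arc_analytic_capacity by (elim exE conjE) (rule that)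
  \<comment> \<open>The matching takes place in radius \<open>1 / (8 * d)\<close> rather than
    \<open>1 / d\<close>, and \<open>\<kappa> * d = \<mu> / r\<close> for that radius
    \<open>r\<close>.\<close>
  define \<mu> where "\<mu> = \<kappa> / 8"
  have \<mu>: "\<mu> > 0" using \<kappa> by (simp add: \<mu>_def)
  define A where "A = (1 + 1 / \<mu>) * (1 + 1 / \<mu>^2)"
  have A: "A > 0" unfolding A_def using \<mu> by (intro mult_pos_pos add_pos_pos) auto
  have main: "\<exists>G U. open U \<and> K \<subseteq> U \<and> G holomorphic_on U \<and>
        (\<forall>z\<in>U. z \<notin> path_image (rectpath (Complex x y) (Complex (x + d) (y + d))) \<longrightarrow>
          cmod (cauchy_defect \<Phi> (Complex x y) (Complex (x + d) (y + d)) z - G z)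
            \<le> (4096 * A) * (L * d) / (1 + cmod (z - Complex x y) / d) ^ 3)"
    if K: "compact K" "connected (- K)" and d: "d > 0"
      and lip: "\<And>u v. cmod (\<Phi> u - \<Phi> v) \<le> L * cmod (u - v)"
      and p: "p \<notin> K" "cmod (p - Complex x y) \<le> 5 * d" for K \<Phi> L d x y p
  proof -
    define lo hi where "lo = Complex x y" and "hi = Complex (x + d) (y + d)"
    have lohi: "Re lo \<le> Re hi" "Im lo \<le> Im hi" using d by (auto simp: lo_def hi_def)
    have L: "L \<ge> 0" using order_trans[OF norm_ge_zero lip[of 0 1]] by simp
    have cont: "continuous_on UNIV \<Phi>"
      by (rule lipschitz_on_continuous_on[of L], rule lipschitz_onI) (use lip L in \<open>auto simp: dist_norm\<close>)
    define M where "M = L * d"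
    have M: "M \<ge> 0" using L d by (simp add: M_def)
    define Q where "Q = path_image (rectpath lo hi)"
    have bnd: "cmod (cauchy_defect \<Phi> lo hi z) \<le> M" if "z \<notin> Q" for z
      using cauchy_defect_lipschitz_bound[OF lip d, of z x y] that by (simp add: M_def Q_def lo_def hi_def)
    \<comment> \<open>The corner is within \<open>5 * d\<close> of \<open>p\<close> and the diameter
      is at most \<open>2 * d\<close>. Beyond distance \<open>8 * d\<close> from \<open>p\<close>
      there is thus neither a point of the square nor one of the arc.\<close>
    have box8: "cmod (z - p) < 8 * d" if "z \<in> cbox lo hi" for z
    proof -
      have "\<bar>Re (z - lo)\<bar> \<le> d" "\<bar>Im (z - lo)\<bar> \<le> d"
        using that by (auto simp: in_cbox_complex_iff lo_def hi_def)
      then have "cmod (z - lo) \<le> 2 * d" using cmod_le[of "z - lo"] by linarith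
      then show ?thesis using p(2) d norm_triangle_ineq4[of "z - lo" "p - lo"] by (simp add: lo_def)
    qed
    have Q8: "Q \<subseteq> cbox lo hi" unfolding Q_def by (rule path_image_rectpath_subset_cbox[OF lohi])
    have far_rect: "cauchy_defect \<Phi> lo hi z = - cauchy_rect \<Phi> lo hi z" if "cmod (z - p) > 8 * d" for z
    proof -
      have "z \<notin> box lo hi" using box8[of z] that box_subset_cbox[of lo hi] by force
      then show ?thesis by (simp add: cauchy_defect_def)
    qed
    have farQ: "z \<notin> Q" if "cmod (z - p) > 8 * d" for z
      using box8[of z] that Q8 by force
    obtain \<gamma> where \<gamma>: "arc \<gamma>" "pathstart \<gamma> = p" "path_image \<gamma> \<subseteq> cball p d - K" "cmod (pathfinish \<gamma> - p) = d"
      using arc_reaching_distance[OF K p(1) d] by blast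
    have \<gamma>d: "path_image \<gamma> \<subseteq> cball p d" using \<gamma>(3) by blast
    obtain g G where g: "g holomorphic_on - path_image \<gamma>" "\<And>z. z \<in> - path_image \<gamma> \<Longrightarrow> cmod (g z) \<le> 1"
      and G: "G holomorphic_on ball 0 (1 / d)" "G 0 = 0"
        "\<And>w. w \<in> ball 0 (1 / d) \<Longrightarrow> w \<noteq> 0 \<Longrightarrow> G w = g (p + 1 / w)" "cmod (deriv G 0) \<ge> \<kappa> * d"
      using cap[rule_format, OF \<gamma>(1,2) d \<gamma>d \<gamma>(4)] unfolding has_pole_function_def by blast
    define r where "r = 1 / (8 * d)"
    have r: "r > 0" using d by (simp add: r_def)
    have "r \<le> 1 / d" using d by (simp add: r_def field_simps)
    then have rd: "w \<in> ball 0 (1 / d)" if "w \<in> ball 0 r" for w :: complex using that by simp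
    have inv8: "cmod (p + 1 / w - p) > 8 * d" if "w \<in> ball 0 r" "w \<noteq> 0" for w
      using that d by (simp add: r_def norm_divide field_simps)
    have far\<gamma>: "z \<in> - path_image \<gamma>" if "cmod (z - p) > 8 * d" for z
      using \<gamma>d that d by (auto simp: dist_norm norm_minus_commute subset_iff)
    define F where "F w = (if w = 0 then 0 else - cauchy_rect \<Phi> lo hi (p + 1 / w))" for w
    have F: "F holomorphic_on ball 0 r"
      unfolding F_def r_def
    proof (rule holomorphic_at_infinity)
      show "(\<lambda>z. - cauchy_rect \<Phi> lo hi z) holomorphic_on {z. 8 * d < cmod (z - p)}"
        by (intro holomorphic_intros holomorphic_on_subset[OF cauchy_rect_holomorphic[OF cont lohi]])
           (use farQ in \<open>auto simp: Q_def\<close>)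
      show "((\<lambda>z. - cauchy_rect \<Phi> lo hi z) \<longlongrightarrow> 0) at_infinity"
        using tendsto_minus[OF cauchy_rect_tendsto_0[OF cont lohi]] by simp
    qed (use d in auto)
    have F0: "F 0 = 0" by (simp add: F_def)
    have F_eq: "F w = cauchy_defect \<Phi> lo hi (p + 1 / w)" if "w \<in> ball 0 r" "w \<noteq> 0" for w
      using far_rect[OF inv8[OF that]] that(2) by (simp add: F_def)
    have F_le: "cmod (F w) \<le> M" if "w \<in> ball 0 r" for w
    proof (cases "w = 0")
      case False
      then show ?thesis using F_eq[OF that] bnd[OF farQ[OF inv8[OF that]]] by simp
    qed (simp add: F0 M)
    have G_le: "cmod (G w) \<le> 1" if "w \<in> ball 0 r" for w
    proof (cases "w = 0")
      case False
      then show ?thesis using G(3)[OF rd[OF that]] g(2)[OF far\<gamma>[OF inv8[OF that]]] by simp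
    qed (simp add: G(2))
    have Ghol: "G holomorphic_on ball 0 r" using holomorphic_on_subset[OF G(1)] rd by blast
    have dG: "cmod (deriv G 0) \<ge> \<mu> / r" using G(4) d by (simp add: \<mu>_def r_def mult.commute)
    obtain \<alpha> \<beta> where ab: "cmod \<alpha> \<le> M / \<mu>" "cmod \<beta> \<le> M * (1 + 1 / \<mu>) / \<mu>^2"
      "\<And>w. w \<in> ball 0 r \<Longrightarrow> cmod (F w - \<alpha> * G w - \<beta> * (G w)^2) \<le> M * (1 + 1 / \<mu>) * (1 + 1 / \<mu>^2) * (cmod w / r)^3"
      by (rule quadratic_matching[OF F F0 F_le Ghol G(2) G_le r \<mu> dG]) (assumption, assumption, rule that)
    define H where "H z = \<alpha> * g z + \<beta> * (g z)^2" for z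
    have far: "cmod (cauchy_defect \<Phi> lo hi z - H z) \<le> M * A * (8 * d / cmod (z - p)) ^ 3"
      if z: "cmod (z - p) > 8 * d" for z
    proof -
      define w where "w = 1 / (z - p)"
      have "z \<noteq> p" using z d by auto
      then have w: "w \<noteq> 0" "p + 1 / w = z" by (auto simp: w_def)
      have wr: "w \<in> ball 0 r" using z d by (simp add: w_def r_def norm_divide frac_less2)
      have "F w - \<alpha> * G w - \<beta> * (G w)^2 = cauchy_defect \<Phi> lo hi z - H z"
        using F_eq[OF wr w(1)] G(3)[OF rd[OF wr] w(1)] by (simp add: w(2) H_def)
      moreover have "cmod w / r = 8 * d / cmod (z - p)"
        by (simp add: w_def r_def norm_divide)
      ultimately show ?thesis using ab(3)[OF wr] by (simp add: A_def mult.assoc)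
    qed
    have near: "cmod (cauchy_defect \<Phi> lo hi z - H z) \<le> M * A" if "z \<notin> Q" "z \<in> - path_image \<gamma>" for z
    proof -
      have "cmod (\<alpha> * g z) \<le> M / \<mu> * 1" unfolding norm_mult
        using ab(1) g(2)[OF that(2)] M \<mu> by (intro mult_mono) auto
      moreover have "cmod (\<beta> * (g z)^2) \<le> M * (1 + 1 / \<mu>) / \<mu>^2 * 1" unfolding norm_mult norm_power
        using ab(2) g(2)[OF that(2)] M \<mu> by (intro mult_mono power_le_one) auto
      ultimately have "cmod (cauchy_defect \<Phi> lo hi z - H z) \<le> M + M / \<mu> + M * (1 + 1 / \<mu>) / \<mu>^2"
        using bnd[OF that(1)] norm_triangle_ineq4[of "cauchy_defect \<Phi> lo hi z" "H z"]
          norm_triangle_ineq[of "\<alpha> * g z" "\<beta> * (g z)^2"] unfolding H_def by linarith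
      also have "\<dots> = M * A" unfolding A_def using \<mu> by (simp add: field_simps)
      finally show ?thesis .
    qed
    show ?thesis
    proof (intro exI conjI ballI impI)
      show "open (- path_image \<gamma>)" using \<gamma>(1) by (simp add: closed_arc_image open_Compl)
      show "K \<subseteq> - path_image \<gamma>" using \<gamma>(3) by blast
      show "H holomorphic_on - path_image \<gamma>" unfolding H_def by (intro holomorphic_intros g)
      fix z assume z: "z \<in> - path_image \<gamma>" "z \<notin> path_image (rectpath (Complex x y) (Complex (x + d) (y + d)))"
      \<comment> \<open>If \<open>cmod (z - p) > 8 * d\<close>, then
        \<open>d * D \<le> 2 * cmod (z - p)\<close> turns the decay into
        \<open>(16 / D) ^ 3\<close>; otherwise \<open>D \<le> 14\<close>. The constant
        \<open>4096 = 16 ^ 3\<close> covers both cases.\<close>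
      define D where "D = 1 + cmod (z - lo) / d"
      have D: "D \<ge> 1" using d by (simp add: D_def)
      have dD: "d * D = d + cmod (z - lo)" using d by (simp add: D_def distrib_left)
      have tri: "cmod (z - lo) \<le> cmod (z - p) + 5 * d"
        using norm_triangle_ineq[of "z - p" "p - lo"] p(2) by (simp add: lo_def)
      have "cmod (cauchy_defect \<Phi> lo hi z - H z) \<le> M * A * (4096 / D ^ 3)"
      proof (cases "cmod (z - p) > 8 * d")
        case True
        have zp: "cmod (z - p) > 0" using True d by linarith
        have "d * D \<le> 2 * cmod (z - p)" using tri True dD d by linarith
        then have "8 * d / cmod (z - p) \<le> 16 / D" using zp D by (simp add: field_simps)
        then have "(8 * d / cmod (z - p)) ^ 3 \<le> (16 / D) ^ 3" using d by (intro power_mono) auto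
        then have "M * A * (8 * d / cmod (z - p)) ^ 3 \<le> M * A * (4096 / D ^ 3)"
          using M A by (intro mult_left_mono) (auto simp: power_divide)
        then show ?thesis using far[OF True] by linarith
      next
        case False
        have "d * D \<le> 14 * d" using tri False dD d by linarith
        then have "D \<le> 16" using d by simp
        then have "D ^ 3 \<le> 16 ^ 3" using D by (intro power_mono) auto
        then have "1 \<le> 4096 / D ^ 3" using D by (simp add: field_simps)
        then have "M * A * 1 \<le> M * A * (4096 / D ^ 3)" using M A by (intro mult_left_mono) auto
        moreover have "z \<notin> Q" using z(2) by (simp add: Q_def lo_def hi_def)
        ultimately show ?thesis using near[OF _ z(1)] by fastforce
      qed
      then show "cmod (cauchy_defect \<Phi> (Complex x y) (Complex (x + d) (y + d)) z - H z)
            \<le> (4096 * A) * (L * d) / (1 + cmod (z - Complex x y) / d) ^ 3"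
        by (simp add: D_def M_def lo_def hi_def mult_ac)
    qed
  qed
  show ?thesis
  proof (intro exI[of _ "4096 * A"] conjI allI impI)
    show "4096 * A > 0" using A by simp
  qed (rule main; assumption?; blast)
qed

section \<open>Summation over the grid\<close>

text \<open>Split the indices at the floor of \<open>a\<close>. On either side the distances to
  \<open>a\<close> are bounded below by distinct natural numbers, so each half is at most the
  convergent series of \<open>(k + 1) powr (-3/2)\<close>.\<close>

lemma shifted_power_sum_bound:
  obtains C :: real where "C > 0"
    and "\<And>a N. (\<Sum>i<N. (1 + \<bar>a - real i\<bar>) powr (-3/2)) \<le> C"
proof -
  define h where "h k = real (Suc k) powr (-3/2)" for k
  have h_nn: "h k \<ge> 0" for k by (simp add: h_def)
  have "summable (\<lambda>k. real k powr (-3/2))" by (subst summable_real_powr_iff) simp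
  then have sh: "summable h" unfolding h_def by (subst summable_Suc_iff)
  have anti: "(1 + s) powr (-3/2) \<le> h k" if "real k \<le> s" for s k
    unfolding h_def using that by (intro powr_mono2') auto
  have "(\<Sum>i<N. (1 + \<bar>a - real i\<bar>) powr (-3/2)) \<le> 2 * suminf h + 1" for a N
  proof -
    define m where "m = \<lfloor>a\<rfloor>"
    have m: "real_of_int m \<le> a" "a < real_of_int m + 1" by (simp_all add: m_def)
    define I J where "I = {i\<in>{..<N}. int i \<le> m}" and "J = {i\<in>{..<N}. m < int i}"
    have IJ: "{..<N} = I \<union> J" "I \<inter> J = {}" "finite I" "finite J" by (auto simp: I_def J_def)
    have "(\<Sum>i\<in>I. (1 + \<bar>a - real i\<bar>) powr (-3/2)) \<le> (\<Sum>i\<in>I. h (nat (m - int i)))"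
      by (intro sum_mono anti) (use m in \<open>auto simp: I_def\<close>)
    also have "\<dots> = sum h ((\<lambda>i. nat (m - int i)) ` I)"
      by (subst sum.reindex) (auto simp: inj_on_def I_def)
    also have "\<dots> \<le> suminf h" by (rule sum_le_suminf[OF sh]) (use IJ h_nn in auto)
    finally have 1: "(\<Sum>i\<in>I. (1 + \<bar>a - real i\<bar>) powr (-3/2)) \<le> suminf h" .
    have "(\<Sum>i\<in>J. (1 + \<bar>a - real i\<bar>) powr (-3/2)) \<le> (\<Sum>i\<in>J. h (nat (int i - m - 1)))"
      by (intro sum_mono anti) (use m in \<open>auto simp: J_def\<close>)
    also have "\<dots> = sum h ((\<lambda>i. nat (int i - m - 1)) ` J)"
      by (subst sum.reindex) (auto simp: inj_on_def J_def)
    also have "\<dots> \<le> suminf h" by (rule sum_le_suminf[OF sh]) (use IJ h_nn in auto)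
    finally have 2: "(\<Sum>i\<in>J. (1 + \<bar>a - real i\<bar>) powr (-3/2)) \<le> suminf h" .
    show ?thesis unfolding IJ(1) using 1 2 IJ by (subst sum.union_disjoint) auto
  qed
  moreover have "2 * suminf h + 1 > 0" using suminf_nonneg[OF sh h_nn] by linarith
  ultimately show ?thesis using that by blast
qed

text \<open>Half of the exponent \<open>3\<close> goes to each coordinate, so that the double sum factors into two
  convergent sums.\<close>

lemma lattice_sum_bound:
  obtains C :: real where "C > 0"
    and "\<And>z x y d N. d > 0 \<Longrightarrow>
      (\<Sum>(i,j)\<in>{..<N}\<times>{..<N}. 1 / (1 + cmod (z - Complex (x + real i * d) (y + real j * d)) / d) ^ 3) \<le> C"
proof -
  obtain C where C: "C > 0" "\<And>a N. (\<Sum>i<N. (1 + \<bar>a - real i\<bar>) powr (-3/2)) \<le> C"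
    using shifted_power_sum_bound by blast
  have "(\<Sum>(i,j)\<in>{..<N}\<times>{..<N}. 1 / (1 + cmod (z - Complex (x + real i * d) (y + real j * d)) / d) ^ 3) \<le> C * C"
    if d: "d > 0" for z x y d N
  proof -
    define a b where "a = (Re z - x) / d" and "b = (Im z - y) / d"
    have summand: "1 / (1 + cmod (z - Complex (x + real i * d) (y + real j * d)) / d) ^ 3
        \<le> (1 + \<bar>a - real i\<bar>) powr (-3/2) * (1 + \<bar>b - real j\<bar>) powr (-3/2)" for i j
    proof -
      define w where "w = z - Complex (x + real i * d) (y + real j * d)"
      define D where "D = 1 + cmod w / d"
      have D: "D > 0" using d by (simp add: D_def add_pos_nonneg)
      have "a - real i = Re w / d" "b - real j = Im w / d"
        using d by (simp_all add: a_def b_def w_def field_simps)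
      then have "\<bar>a - real i\<bar> = \<bar>Re w\<bar> / d" "\<bar>b - real j\<bar> = \<bar>Im w\<bar> / d"
        using d by (simp_all add: abs_divide)
      then have le: "1 + \<bar>a - real i\<bar> \<le> D" "1 + \<bar>b - real j\<bar> \<le> D"
        using d abs_Re_le_cmod[of w] abs_Im_le_cmod[of w] by (simp_all add: D_def divide_right_mono)
      have "1 / D ^ 3 = D powr (-3)" using D by (simp add: powr_minus_divide powr_numeral)
      also have "\<dots> = D powr (-3/2) * D powr (-3/2)" by (simp flip: powr_add)
      also have "\<dots> \<le> (1 + \<bar>a - real i\<bar>) powr (-3/2) * (1 + \<bar>b - real j\<bar>) powr (-3/2)"
        by (intro mult_mono powr_mono2' le) auto
      finally show ?thesis by (simp add: D_def w_def)
    qed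
    have "(\<Sum>(i,j)\<in>{..<N}\<times>{..<N}. 1 / (1 + cmod (z - Complex (x + real i * d) (y + real j * d)) / d) ^ 3)
       \<le> (\<Sum>(i,j)\<in>{..<N}\<times>{..<N}. (1 + \<bar>a - real i\<bar>) powr (-3/2) * (1 + \<bar>b - real j\<bar>) powr (-3/2))"
      by (intro sum_mono) (use summand in \<open>auto split: prod.splits\<close>)
    also have "\<dots> = (\<Sum>i<N. (1 + \<bar>a - real i\<bar>) powr (-3/2)) * (\<Sum>j<N. (1 + \<bar>b - real j\<bar>) powr (-3/2))"
      by (simp add: sum_product sum.cartesian_product)
    also have "\<dots> \<le> C * C"
      by (intro mult_mono C(2) sum_nonneg) (use C(1) in auto)
    finally show ?thesis .
  qed
  moreover have "C * C > 0" using C(1) by simp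
  ultimately show ?thesis using that by blast
qed

text \<open>A Tietze extension is uniformly continuous on a closed disc containing \<open>K\<close>,
  and composing it with the nearest-point projection onto that disc, which is 1-Lipschitz, carries
  this over to the plane.\<close>

lemma uniformly_continuous_extension:
  assumes K: "compact K" and f: "continuous_on K (f :: complex \<Rightarrow> complex)"
  obtains F where "uniformly_continuous_on UNIV F" "\<And>z. z \<in> K \<Longrightarrow> F z = f z"
proof -
  obtain B where B: "B > 0" "\<And>z. z \<in> K \<Longrightarrow> cmod z \<le> B"
    using compact_imp_bounded[OF K] bounded_pos by metis
  obtain g where g: "continuous_on UNIV g" "\<And>z. z \<in> K \<Longrightarrow> g z = f z"
    using Tietze_unbounded[OF f, of UNIV] compact_imp_closed[OF K] by auto
  define c where "c = closest_point (cball (0::complex) B)"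
  have c_in: "c z \<in> cball 0 B" for z
    unfolding c_def by (rule closest_point_in_set) (use B(1) in auto)
  have lip: "dist (c z) (c w) \<le> dist z w" for z w
    unfolding c_def by (rule closest_point_lipschitz) (use B(1) in auto)
  have ug: "uniformly_continuous_on (cball 0 B) g"
    by (rule compact_uniformly_continuous[OF continuous_on_subset[OF g(1)]]) auto
  show ?thesis
  proof (rule that[of "g \<circ> c"])
    show "uniformly_continuous_on UNIV (g \<circ> c)"
      unfolding uniformly_continuous_on_def
    proof (intro allI impI)
      fix e :: real assume "e > 0"
      then obtain d where d: "d > 0" "\<And>x y. x \<in> cball 0 B \<Longrightarrow> y \<in> cball 0 B \<Longrightarrow> dist y x < d \<Longrightarrow> dist (g y) (g x) < e"
        using ug unfolding uniformly_continuous_on_def by meson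
      have "dist ((g \<circ> c) y) ((g \<circ> c) x) < e" if "dist y x < d" for x y
        using d(2)[OF c_in c_in le_less_trans[OF lip that]] by simp
      then show "\<exists>d>0. \<forall>x\<in>UNIV. \<forall>y\<in>UNIV. dist y x < d \<longrightarrow> dist ((g \<circ> c) y) ((g \<circ> c) x) < e"
        using d(1) by blast
    qed
    show "(g \<circ> c) z = f z" if "z \<in> K" for z
      using B(2)[OF that] g(2)[OF that] by (simp add: c_def closest_point_self)
  qed
qed

theorem mergelyan:
  assumes K: "compact K" and conn: "connected (- K)" and f: "continuous_on K f" "f holomorphic_on interior K"
  shows "poly_approximable K f"
proof (rule poly_approximable_limit)
  fix \<epsilon> :: real assume \<epsilon>: "\<epsilon> > 0"
  obtain C where C: "C > 0"
    and repl: "\<forall>K \<Phi> L d x y p. compact K \<longrightarrow> connected (- K) \<longrightarrow> d > 0 \<longrightarrow>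
      (\<forall>u v. cmod (\<Phi> u - \<Phi> v) \<le> L * cmod (u - v)) \<longrightarrow> p \<notin> K \<longrightarrow> cmod (p - Complex x y) \<le> 5 * d \<longrightarrow>
      (\<exists>G U. open U \<and> K \<subseteq> U \<and> G holomorphic_on U \<and>
        (\<forall>z\<in>U. z \<notin> path_image (rectpath (Complex x y) (Complex (x + d) (y + d))) \<longrightarrow>
          cmod (cauchy_defect \<Phi> (Complex x y) (Complex (x + d) (y + d)) z - G z)
            \<le> C * (L * d) / (1 + cmod (z - Complex x y) / d) ^ 3))"
    using cauchy_defect_replacement by (elim exE conjE) (rule that)
  obtain C' where C': "C' > 0" and lattice: "\<And>z x y d N. d > 0 \<Longrightarrow>
      (\<Sum>(i,j)\<in>{..<N}\<times>{..<N}. 1 / (1 + cmod (z - Complex (x + real i * d) (y + real j * d)) / d) ^ 3) \<le> C'"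
    using lattice_sum_bound by blast
  \<comment> \<open>Regularisation will cost \<open>2 * e\<close> and the replaced defects
    \<open>2 * C * C' * e\<close>; the 3 in place of 2 makes the final inequality strict.\<close>
  define e where "e = \<epsilon> / (3 + 2 * C * C')"
  have den: "3 + 2 * C * C' > 0" using C C' by (simp add: add_pos_pos)
  then have e: "e > 0" using \<epsilon> by (simp add: e_def)
  obtain F where F: "uniformly_continuous_on UNIV F" "\<And>z. z \<in> K \<Longrightarrow> F z = f z"
    using uniformly_continuous_extension[OF K f(1)] by blast
  obtain d0 where d0: "d0 > 0" "\<And>x y. dist y x < d0 \<Longrightarrow> dist (F y) (F x) < e"
    using F(1) e unfolding uniformly_continuous_on_def by (metis UNIV_I)
  define d where "d = d0 / 2"
  have d: "d > 0" using d0 by (simp add: d_def)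
  have Fe: "cmod (F z - F w) \<le> e" if "cmod (z - w) \<le> d" for z w
    using d0(2)[of z w] that d0(1) by (simp add: d_def dist_norm)
  obtain \<Phi> where \<Phi>: "\<And>z. cmod (\<Phi> z - F z) \<le> 2 * e"
    "\<And>z w. cmod (\<Phi> z - \<Phi> w) \<le> 2 * e / d * cmod (z - w)"
    "\<And>c r. F holomorphic_on ball c (r + 2 * d) \<Longrightarrow> \<Phi> holomorphic_on ball c r"
    using lipschitz_regularisation[OF uniformly_continuous_imp_continuous[OF F(1)] d Fe] by blast
  have cont\<Phi>: "continuous_on UNIV \<Phi>"
    by (rule lipschitz_on_continuous_on[of "2 * e / d"], rule lipschitz_onI) (use \<Phi>(2) e d in \<open>auto simp: dist_norm\<close>)
  obtain B where B: "B > 0" "\<And>z. z \<in> K \<Longrightarrow> cmod z \<le> B"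
    using compact_imp_bounded[OF K] bounded_pos by metis
  define S where "S = B + 1"
  obtain N :: nat where N: "2 * S < N * d" using reals_Archimedean3[OF d] by blast
  define lo where "lo i j = Complex (- S + real i * d) (- S + real j * d)" for i j :: nat
  \<comment> \<open>Written with \<open>+ d\<close> to fit the replacement lemma;
    \<open>hi_alt\<close> relates it to the \<open>Suc\<close> form of the grid
    decomposition.\<close>
  define hi where "hi i j = Complex (- S + real i * d + d) (- S + real j * d + d)" for i j :: nat
  have hi_alt: "lo (Suc i) (Suc j) = hi i j" for i j
    by (simp add: lo_def hi_def algebra_simps)
  \<comment> \<open>Of the radius \<open>5 * d\<close>, averaging uses up \<open>2 * d\<close>, and
    the remaining \<open>3 * d\<close> contains the cell. For a bad cell the same radius supplies
    the point \<open>p\<close> outside \<open>K\<close>.\<close>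
  define bad where "bad = {(i, j). i < N \<and> j < N \<and> \<not> ball (lo i j) (5 * d) \<subseteq> K}"
  define a b where "a = Complex (- S) (- S)" and "b = Complex (- S + N * d) (- S + N * d)"
  have badN: "bad \<subseteq> {..<N} \<times> {..<N}" by (auto simp: bad_def)
  then have fin: "finite bad" by (rule finite_subset) simp
  have lohi: "Re (lo i j) \<le> Re (hi i j)" "Im (lo i j) \<le> Im (hi i j)" for i j
    using d by (auto simp: lo_def hi_def)
  have ab: "Re a \<le> Re b" "Im a \<le> Im b" using N B by (auto simp: a_def b_def S_def)
  define repl_by where "repl_by q G U \<longleftrightarrow> open U \<and> K \<subseteq> U \<and> G holomorphic_on U \<and>
        (\<forall>z\<in>U. z \<notin> path_image (rectpath (lo (fst q) (snd q)) (hi (fst q) (snd q))) \<longrightarrow>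
          cmod (cauchy_defect \<Phi> (lo (fst q) (snd q)) (hi (fst q) (snd q)) z - G z)
            \<le> C * (2 * e / d * d) / (1 + cmod (z - lo (fst q) (snd q)) / d) ^ 3)" for q G U
  have "\<exists>G U. repl_by q G U" if "q \<in> bad" for q
  proof -
    have "\<not> ball (lo (fst q) (snd q)) (5 * d) \<subseteq> K" using that by (simp add: bad_def case_prod_beta)
    then obtain p where p: "p \<in> ball (lo (fst q) (snd q)) (5 * d)" "p \<notin> K" by blast
    then have le: "cmod (p - Complex (- S + real (fst q) * d) (- S + real (snd q) * d)) \<le> 5 * d"
      by (simp add: lo_def dist_norm norm_minus_commute)
    show ?thesis
      unfolding repl_by_def lo_def hi_def by (rule repl[rule_format, OF K conn d \<Phi>(2) p(2) le])
  qed
  then obtain G U where "\<And>q. q \<in> bad \<Longrightarrow> repl_by q (G q) (U q)" by metis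
  then have GU: "\<And>q. q \<in> bad \<Longrightarrow> open (U q)" "\<And>q. q \<in> bad \<Longrightarrow> K \<subseteq> U q"
      "\<And>q. q \<in> bad \<Longrightarrow> G q holomorphic_on U q"
    and GU_le: "\<And>q z. q \<in> bad \<Longrightarrow> z \<in> U q \<Longrightarrow>
      z \<notin> path_image (rectpath (lo (fst q) (snd q)) (hi (fst q) (snd q))) \<Longrightarrow>
      cmod (cauchy_defect \<Phi> (lo (fst q) (snd q)) (hi (fst q) (snd q)) z - G q z)
        \<le> C * (2 * e / d * d) / (1 + cmod (z - lo (fst q) (snd q)) / d) ^ 3"
    unfolding repl_by_def by blast+
  define M where "M = box a b \<inter> (\<Inter>q\<in>bad. U q)"
  define \<Psi> where "\<Psi> z = cauchy_rect \<Phi> a b z + (\<Sum>q\<in>bad. G q z)" for z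
  have "open M" unfolding M_def using GU(1) fin by (intro open_Int open_INT) auto
  have KM: "K \<subseteq> M"
  proof
    fix z assume z: "z \<in> K"
    have "\<bar>Re z\<bar> \<le> B" "\<bar>Im z\<bar> \<le> B" using B(2)[OF z] abs_Re_le_cmod abs_Im_le_cmod order_trans by blast+
    then have "z \<in> box a b" using N by (auto simp: in_box_complex_iff a_def b_def S_def)
    then show "z \<in> M" using GU(2) z by (auto simp: M_def)
  qed
  have hol_big: "cauchy_rect \<Phi> a b holomorphic_on box a b"
    by (rule holomorphic_on_subset[OF cauchy_rect_holomorphic[OF cont\<Phi> ab]])
       (use path_image_rectpath_inter_box[OF ab] in auto)
  have "G q holomorphic_on M" if "q \<in> bad" for q
    by (rule holomorphic_on_subset[OF GU(3)[OF that]]) (use that in \<open>auto simp: M_def\<close>)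
  then have hol\<Psi>: "\<Psi> holomorphic_on M"
    unfolding \<Psi>_def by (intro holomorphic_intros holomorphic_on_subset[OF hol_big]) (auto simp: M_def)
  then have cont: "continuous_on M (\<lambda>z. cmod (\<Phi> z - \<Psi> z))"
    by (intro continuous_intros continuous_on_subset[OF cont\<Phi>] holomorphic_on_imp_continuous_on) auto
  \<comment> \<open>The estimate is made on the open set \<open>M\<close>: points of
    \<open>K\<close> on grid lines are approached from points off the lines, which need not belong
    to \<open>K\<close>.\<close>
  have bound: "cmod (\<Phi> z - \<Psi> z) \<le> C * (2 * e) * C'" if "z \<in> M" for z
  proof (rule le_off_grid_imp_le[OF \<open>open M\<close> cont d _ that])
    fix z assume z: "z \<in> M" and off: "\<And>i::nat. Re z \<noteq> - S + i * d" "\<And>j::nat. Im z \<noteq> - S + j * d"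
    have zb: "z \<in> box a b" using z by (simp add: M_def)
    have zpath: "z \<notin> path_image (rectpath (lo i j) (hi i j))" for i j
      using off[of i] off[of j] off[of "Suc i"] off[of "Suc j"] lohi[of i j]
      by (auto simp: path_image_rectpath lo_def hi_def algebra_simps)
    have good: "cauchy_defect \<Phi> (lo i j) (hi i j) z = 0" if "i < N" "j < N" "(i, j) \<notin> bad" for i j
    proof (rule cauchy_defect_holomorphic_eq_0[OF _ lohi zpath])
      have sub: "ball (lo i j) (3 * d + 2 * d) \<subseteq> K" using that by (auto simp: bad_def)
      then have "ball (lo i j) (3 * d + 2 * d) \<subseteq> interior K" by (simp add: interior_maximal)
      then have "f holomorphic_on ball (lo i j) (3 * d + 2 * d)" using f(2) holomorphic_on_subset by blast
      then have "F holomorphic_on ball (lo i j) (3 * d + 2 * d)"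
        by (rule holomorphic_transform) (use F(2) sub in auto)
      then have hol: "\<Phi> holomorphic_on ball (lo i j) (3 * d)" by (rule \<Phi>(3))
      show "\<Phi> holomorphic_on cbox (lo i j) (hi i j)"
      proof (rule holomorphic_on_subset[OF hol], rule subsetI)
        fix w assume "w \<in> cbox (lo i j) (hi i j)"
        then have "\<bar>Re (w - lo i j)\<bar> \<le> d" "\<bar>Im (w - lo i j)\<bar> \<le> d"
          by (auto simp: in_cbox_complex_iff lo_def hi_def)
        then have "cmod (w - lo i j) \<le> 2 * d" using cmod_le[of "w - lo i j"] by linarith
        then show "w \<in> ball (lo i j) (3 * d)" using d by (simp add: dist_norm norm_minus_commute)
      qed
    qed
    have "(\<Sum>(i,j)\<in>{..<N}\<times>{..<N}. cauchy_defect \<Phi> (lo i j) (hi i j) z) = (\<Sum>(i,j)\<in>bad. cauchy_defect \<Phi> (lo i j) (hi i j) z)"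
      by (rule sum.mono_neutral_right) (use good in \<open>auto simp: bad_def\<close>)
    then have "\<Phi> z = cauchy_rect \<Phi> a b z + (\<Sum>(i,j)\<in>bad. cauchy_defect \<Phi> (lo i j) (hi i j) z)"
      using cauchy_grid_decomposition[OF cont\<Phi> d off zb[unfolded a_def b_def]]
      by (simp only: hi_alt lo_def[symmetric] a_def b_def)
    then have "\<Phi> z - \<Psi> z = (\<Sum>q\<in>bad. cauchy_defect \<Phi> (lo (fst q) (snd q)) (hi (fst q) (snd q)) z - G q z)"
      by (simp add: \<Psi>_def sum_subtractf case_prod_beta')
    also have "cmod \<dots> \<le> (\<Sum>q\<in>bad. C * (2 * e / d * d) / (1 + cmod (z - lo (fst q) (snd q)) / d) ^ 3)"
    proof (intro sum_norm_le)
      fix q assume q: "q \<in> bad"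
      then have "z \<in> U q" using z by (auto simp: M_def)
      then show "cmod (cauchy_defect \<Phi> (lo (fst q) (snd q)) (hi (fst q) (snd q)) z - G q z)
            \<le> C * (2 * e / d * d) / (1 + cmod (z - lo (fst q) (snd q)) / d) ^ 3"
        by (rule GU_le[OF q _ zpath])
    qed
    also have "\<dots> \<le> (\<Sum>q\<in>{..<N}\<times>{..<N}. C * (2 * e / d * d) / (1 + cmod (z - lo (fst q) (snd q)) / d) ^ 3)"
      by (intro sum_mono2 badN) (use C e d in \<open>auto intro!: divide_nonneg_nonneg add_nonneg_nonneg\<close>)
    \<comment> \<open>The Lipschitz constant \<open>2 * e / d\<close> times the side
      \<open>d\<close> is \<open>2 * e\<close>, so the total depends neither on the mesh nor on the
      number of cells.\<close>
    also have "\<dots> = C * (2 * e) * (\<Sum>(i,j)\<in>{..<N}\<times>{..<N}. 1 / (1 + cmod (z - Complex (- S + real i * d) (- S + real j * d)) / d) ^ 3)"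
      using d by (simp add: sum_distrib_left case_prod_beta' lo_def)
    also have "\<dots> \<le> C * (2 * e) * C'"
      by (intro mult_left_mono lattice d) (use C e in auto)
    finally show "cmod (\<Phi> z - \<Psi> z) \<le> C * (2 * e) * C'" .
  qed
  have "poly_approximable K \<Psi>" by (rule runge_polynomial[OF K conn \<open>open M\<close> KM hol\<Psi>])
  moreover have "cmod (f z - \<Psi> z) < \<epsilon>" if z: "z \<in> K" for z
  proof -
    have "cmod (f z - \<Psi> z) \<le> cmod (\<Phi> z - F z) + cmod (\<Phi> z - \<Psi> z)"
      unfolding F(2)[OF z, symmetric] by norm
    also have "\<dots> \<le> 2 * e + C * (2 * e) * C'" using \<Phi>(1) bound KM z by (intro add_mono) auto
    also have "\<dots> < e * (3 + 2 * C * C')" using e by (simp add: algebra_simps)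
    also have "\<dots> = \<epsilon>" using den by (simp add: e_def)
    finally show ?thesis .
  qed
  ultimately show "\<exists>g. poly_approximable K g \<and> (\<forall>z\<in>K. cmod (f z - g z) < \<epsilon>)" by blast
qed

section \<open>Removing the zeros\<close>

text \<open>The set \<open>{\<bar>f\<bar> \<le> \<delta>}\<close> has empty interior, so it contains no component of the complement of
  \<open>{\<bar>f\<bar> = \<delta>}\<close>, and the map \<open>f\<close> from \<open>{\<bar>f\<bar> = \<delta>}\<close> to the circle of radius \<open>\<delta>\<close> extends to it.\<close>

lemma nonvanishing_perturbation:
  fixes f :: "complex \<Rightarrow> complex"
  assumes E: "compact E" and f: "continuous_on E f" and nz: "\<forall>z\<in>closure (interior E). f z \<noteq> 0" and e: "e > 0"
  obtains h where "continuous_on E h" "\<And>z. z \<in> E \<Longrightarrow> h z \<noteq> 0" "\<And>z. z \<in> E \<Longrightarrow> cmod (f z - h z) \<le> e"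
    "\<And>z. z \<in> interior E \<Longrightarrow> h z = f z"
proof -
  let ?C = "closure (interior E)"
  have CE: "?C \<subseteq> E" using E by (simp add: closure_minimal compact_imp_closed interior_subset)
  have "compact ?C" 
    unfolding compact_closure by (rule bounded_subset[OF compact_imp_bounded[OF E] interior_subset])
  \<comment> \<open>The level \<delta> lies below the minimum of \<open>cmod (f z)\<close> on the
    closure of the interior. Where \<open>f\<close> will be changed, old and new values have modulus
    at most \<delta>, so they differ by at most \<open>2 * \<delta>\<close>.\<close>
  have "\<exists>\<delta>>0. 2 * \<delta> \<le> e \<and> (\<forall>z\<in>?C. cmod (f z) > \<delta>)"
  proof (cases "?C = {}")
    case True
    then show ?thesis using e by (intro exI[of _ "e / 2"]) auto
  next
    case False
    have "continuous_on ?C (\<lambda>z. cmod (f z))" by (intro continuous_intros continuous_on_subset[OF f CE])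
    from continuous_attains_inf[OF \<open>compact ?C\<close> False this]
    obtain z0 where z0: "z0 \<in> ?C" "\<And>z. z \<in> ?C \<Longrightarrow> cmod (f z0) \<le> cmod (f z)" by blast
    define m where "m = cmod (f z0)"
    have "m > 0" using nz z0(1) by (simp add: m_def)
    show ?thesis
    proof (intro exI[of _ "min (e / 2) (m / 2)"] conjI ballI)
      fix z assume "z \<in> ?C"
      then have "m \<le> cmod (f z)" using z0(2) by (simp add: m_def)
      then show "min (e / 2) (m / 2) < cmod (f z)" using \<open>m > 0\<close> by linarith
    qed (use e \<open>m > 0\<close> in auto)
  qed
  then obtain \<delta> where \<delta>: "\<delta> > 0" "2 * \<delta> \<le> e" "\<And>z. z \<in> ?C \<Longrightarrow> cmod (f z) > \<delta>" by blast
  have nf: "continuous_on E (\<lambda>z. cmod (f z))" by (intro continuous_intros f)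
  define A where "A = E \<inter> (\<lambda>z. cmod (f z)) -` {..\<delta>}"
  define A' where "A' = E \<inter> (\<lambda>z. cmod (f z)) -` {\<delta>..}"
  define S where "S = E \<inter> (\<lambda>z. cmod (f z)) -` {\<delta>}"
  have clE: "closed E" using E by (rule compact_imp_closed)
  have cl: "closed A" "closed A'" "closed S"
    unfolding A_def A'_def S_def by (intro continuous_closed_preimage nf clE; simp)+
  have "S = E \<inter> S" by (auto simp: S_def)
  then have cS: "compact S" using E cl(3) by (metis compact_Int_closed)
  have contS: "continuous_on S f" by (rule continuous_on_subset[OF f]) (auto simp: S_def)
  have fS: "f \<in> S \<rightarrow> sphere 0 \<delta>" by (auto simp: S_def)
  have dis: "C \<inter> - A \<noteq> {}" if C: "C \<in> components (- S)" for C
  proof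
    assume "C \<inter> - A = {}"
    then have "C \<subseteq> E" by (auto simp: A_def)
    moreover have "open C" using C cl(3) by (meson open_Compl open_components)
    ultimately have "C \<subseteq> interior E" by (simp add: interior_maximal)
    moreover obtain z where "z \<in> C" using C in_components_nonempty by blast
    ultimately have "z \<in> ?C" using closure_subset by blast
    then have "cmod (f z) > \<delta>" by (rule \<delta>(3))
    moreover have "z \<in> A" using \<open>C \<inter> - A = {}\<close> \<open>z \<in> C\<close> by blast
    ultimately show False by (simp add: A_def)
  qed
  \<comment> \<open>The extension into the circle is defined off an exceptional set
    \<open>T\<close>. By \<open>dis\<close> every component of the complement of \<open>S\<close>
    has points outside \<open>A\<close>, so \<open>T\<close> can be kept away from
    \<open>A\<close>.\<close>
  obtain T g where T: "T \<subseteq> - A" and g: "continuous_on (- T) g" "g \<in> (- T) \<rightarrow> sphere 0 \<delta>" "\<And>x. x \<in> S \<Longrightarrow> g x = f x"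
    using extend_map_UNIV_to_sphere_cofinite[of \<delta> S f 0 "- A"] \<delta>(1) cS contS fS dis
    by (metis DIM_complex less_imp_le order_refl)
  have AT: "A \<subseteq> - T" using T by blast
  have gA: "cmod (g z) = \<delta>" if "z \<in> A" for z
    using g(2) AT that by (auto simp: Pi_iff)
  define h where "h z = (if cmod (f z) \<le> \<delta> then g z else f z)" for z
  have "continuous_on (A \<union> A') h"
    unfolding h_def
  proof (rule continuous_on_cases[OF cl(1,2)])
    show "continuous_on A g" by (rule continuous_on_subset[OF g(1) AT])
    show "continuous_on A' f" by (rule continuous_on_subset[OF f]) (auto simp: A'_def)
    show "\<forall>x. x \<in> A \<and> \<not> cmod (f x) \<le> \<delta> \<or> x \<in> A' \<and> cmod (f x) \<le> \<delta> \<longrightarrow> g x = f x"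
      by (auto simp: A_def A'_def S_def intro!: g(3))
  qed
  moreover have "A \<union> A' = E" by (auto simp: A_def A'_def)
  ultimately have hc: "continuous_on E h" by simp
  show ?thesis
  proof (rule that[OF hc])
    fix z assume z: "z \<in> E"
    show "h z \<noteq> 0"
    proof (cases "cmod (f z) \<le> \<delta>")
      case True
      then have "cmod (g z) = \<delta>" using z by (intro gA) (simp add: A_def)
      then show ?thesis using True \<delta>(1) by (auto simp: h_def)
    next
      case False
      then show ?thesis using \<delta>(1) by (auto simp: h_def)
    qed
    show "cmod (f z - h z) \<le> e"
    proof (cases "cmod (f z) \<le> \<delta>")
      case True
      then have "cmod (g z) = \<delta>" using z by (intro gA) (simp add: A_def)
      then show ?thesis using True \<delta>(2) norm_triangle_ineq4[of "f z" "g z"] by (simp add: h_def)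
    qed (use e in \<open>simp add: h_def\<close>)
  next
    fix z assume "z \<in> interior E"
    then have "cmod (f z) > \<delta>" by (intro \<delta>(3)) (use closure_subset in blast)
    then show "h z = f z" by (simp add: h_def)
  qed
qed

theorem proposition2:
  fixes E :: "complex set" and f :: "complex \<Rightarrow> complex"
  assumes "compact E"
    and "connected (UNIV - E)"
    and "f \<in> cont_analytic E"
    and "\<forall>z \<in> closure (interior E). f z \<noteq> 0"
  shows "\<forall>\<epsilon>::real. \<epsilon> > 0 \<longrightarrow>
    (\<exists>P :: complex poly. (\<forall>z\<in>E. poly P z \<noteq> 0) \<and> (\<forall>z\<in>E. cmod (f z - poly P z) < \<epsilon>))"
proof (intro allI impI)
  fix \<epsilon> :: real assume "\<epsilon> > 0"
  have f: "continuous_on E f" "f holomorphic_on interior E"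
    using assms(3) by (auto simp: cont_analytic_def analytic_imp_holomorphic)
  obtain h where h: "continuous_on E h" "\<And>z. z \<in> E \<Longrightarrow> h z \<noteq> 0"
    "\<And>z. z \<in> E \<Longrightarrow> cmod (f z - h z) \<le> \<epsilon> / 2" "\<And>z. z \<in> interior E \<Longrightarrow> h z = f z"
    using nonvanishing_perturbation[OF assms(1) f(1) assms(4), of "\<epsilon> / 2"] \<open>\<epsilon> > 0\<close> by auto
  have "h holomorphic_on interior E" using f(2) by (rule holomorphic_transform) (simp add: h(4))
  moreover have "connected (- E)" using assms(2) by (simp add: Compl_eq_Diff_UNIV)
  ultimately have approx: "poly_approximable E h" using mergelyan assms(1) h(1) by blast
  have "\<exists>m>0. \<forall>z\<in>E. m \<le> cmod (h z)"
  proof (cases "E = {}")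
    case False
    have "continuous_on E (\<lambda>z. cmod (h z))" by (intro continuous_intros h(1))
    from continuous_attains_inf[OF assms(1) False this] show ?thesis
      using h(2) by (metis zero_less_norm_iff)
  qed (auto intro: exI[of _ 1])
  then obtain m where m: "m > 0" "\<And>z. z \<in> E \<Longrightarrow> m \<le> cmod (h z)" by blast
  \<comment> \<open>An error below \<open>m\<close> keeps the polynomial nonzero, since
    \<open>m \<le> cmod (h z)\<close>; an error below \<open>\<epsilon> / 2\<close> adds to the one
    from replacing \<open>f\<close> by \<open>h\<close>.\<close>
  have "min m (\<epsilon> / 2) > 0" using m(1) \<open>\<epsilon> > 0\<close> by simp
  then obtain P where P: "\<And>z. z \<in> E \<Longrightarrow> cmod (h z - poly P z) < min m (\<epsilon> / 2)"
    using approx unfolding poly_approximable_def by meson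
  have "poly P z \<noteq> 0" if "z \<in> E" for z using P[OF that] m(2)[OF that] by auto
  moreover have "cmod (f z - poly P z) < \<epsilon>" if "z \<in> E" for z
    using norm_triangle_ineq[of "f z - h z" "h z - poly P z"] h(3)[OF that] P[OF that] by simp
  ultimately show "\<exists>P. (\<forall>z\<in>E. poly P z \<noteq> 0) \<and> (\<forall>z\<in>E. cmod (f z - poly P z) < \<epsilon>)" by blast
qed

end
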